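(* Let $n\ge2$, let $c\ge1$, and let $D$ be an unbounded $c$-John domain in $\mathbb{R}^n$ with $D\neq\mathbb{R}^n$. Let $0<\delta<1$ and $1\le p,q<\infty$ be such that $p<n/\delta$ and $0\le1/p-1/q\le\delta/n$. Suppose that at least one of the following conditions holds: (A) $\overline{\dim}_A(\partial D)<n-\delta p$; (B) $\underline{\dim}_A(\partial D)>n-\delta p$ and $\partial D$ is unbounded. Then the fractional $(\delta,q,p)$-Hardy inequality holds in $D$, i.e. there is a constant $C>0$ such that $$\int_{D}\frac{|u(x)|^q}{\mathrm{dist}(x,\partial D)^{q(\delta+n(1/q-1/p))}}\,dx\le C\Big(\int_D\int_D\frac{|u(x)-u(y)|^p}{|x-y|^{n+\delta p}}\,dy\,dx\Big)^{q/p}$$ for all $u\in C_0(D)$.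
   Context: A domain $D$ in $\mathbb{R}^n$ with $n\ge2$ is a $c$-John domain, $c\ge1$, if each pair of points $x_1,x_2\in D$ can be joined by a rectifiable curve $\gamma:[0,\ell]\to D$ parametrized by its arc length (so $\gamma(0)=x_1$, $\gamma(\ell)=x_2$) such that $\mathrm{dist}(\gamma(t),\partial D)\ge\min\{t,\ell-t\}/c$ for every $t\in[0,\ell]$. $C_0(D)$ is the family of all continuous functions $u:D\to\mathbb{R}$ with compact support in $D$. $B^n(x,r)$ is the open ball with center $x$ and radius $r$. Let $E\neq\emptyset$ be a set in $\mathbb{R}^n$. The upper Assouad dimension $\overline{\dim}_A(E)$ is the infimum of all $\lambda\ge0$ for which there exists a constant $C=C(E,\lambda)>0$ such that for every $x\in E$ and all $0<r<R<2\,\mathrm{diam}(E)$ the set $E\cap B^n(x,R)$ can be covered by at most $C(R/r)^\lambda$ balls that are centered in $E$ and have radius $r$. The lower Assouad dimension $\underline{\dim}_A(E)$ is the supremum of all $\lambda\ge0$ for which there exists a constant $C=C(E,\lambda)>0$ such that for every $x\in E$ and all $0<r<R<2\,\mathrm{diam}(E)$ at least $C(R/r)^\lambda$ balls centered in $E$ and with radius $r$ are needed to cover the set $E\cap B^n(x,R)$. *)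

theory Defs
  imports "HOL-Analysis.Analysis"
begin

definition curve_length :: "(real \<Rightarrow> 'a::metric_space) \<Rightarrow> real \<Rightarrow> real \<Rightarrow> ennreal" where
  "curve_length \<gamma> a b =
    (SUP (m, t) \<in> {(m :: nat, t :: nat \<Rightarrow> real).
         t 0 = a \<and> t m = b \<and> (\<forall>i<m. t i \<le> t (Suc i))}.
       \<Sum>i<m. ennreal (dist (\<gamma> (t i)) (\<gamma> (t (Suc i)))))"

text \<open>Finiteness of the length, i.e. rectifiability, is part of this condition.\<close>

definition arc_length_parametrized :: "(real \<Rightarrow> 'a::metric_space) \<Rightarrow> real \<Rightarrow> bool" where
  "arc_length_parametrized \<gamma> l \<longleftrightarrow>
     0 \<le> l \<and> continuous_on {0..l} \<gamma> \<and> (\<forall>t\<in>{0..l}. curve_length \<gamma> 0 t = ennreal t)"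

definition domain :: "'a::euclidean_space set \<Rightarrow> bool" where
  "domain D \<longleftrightarrow> open D \<and> connected D \<and> D \<noteq> {}"

definition john_domain :: "real \<Rightarrow> 'a::euclidean_space set \<Rightarrow> bool" where
  "john_domain c D \<longleftrightarrow> domain D \<and>
     (\<forall>x1\<in>D. \<forall>x2\<in>D. \<exists>\<gamma> l.
        arc_length_parametrized \<gamma> l \<and> \<gamma> ` {0..l} \<subseteq> D \<and> \<gamma> 0 = x1 \<and> \<gamma> l = x2 \<and>
        (\<forall>t\<in>{0..l}. infdist (\<gamma> t) (frontier D) \<ge> min t (l - t) / c))"

text \<open>The library's real-valued \<^const>\<open>diameter\<close> is meaningless for unbounded sets; here they
  have diameter \<open>\<infinity>\<close>. For the empty set, which is never used, the value is \<open>-\<infinity>\<close>.\<close>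

definition ediameter :: "'a::metric_space set \<Rightarrow> ereal" where
  "ediameter E = (SUP x\<in>E. SUP y\<in>E. ereal (dist x y))"

definition ball_cover :: "'a::metric_space set \<Rightarrow> 'a \<Rightarrow> real \<Rightarrow> real \<Rightarrow> 'a set \<Rightarrow> bool" where
  "ball_cover E x R r F \<longleftrightarrow> F \<subseteq> E \<and> E \<inter> ball x R \<subseteq> (\<Union>z\<in>F. ball z r)"

text \<open>Both dimensions are extended reals: for a singleton there are no admissible radii, so the
  lower dimension is then \<open>\<infinity>\<close>.\<close>

definition upper_assouad_dim :: "'a::euclidean_space set \<Rightarrow> ereal" where
  "upper_assouad_dim E = Inf {ereal s | s. 0 \<le> s \<and>
     (\<exists>C>0. \<forall>x\<in>E. \<forall>r R. 0 < r \<and> r < R \<and> ereal R < 2 * ediameter E \<longrightarrow>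
        (\<exists>F. finite F \<and> ball_cover E x R r F \<and> real (card F) \<le> C * (R / r) powr s))}"

definition lower_assouad_dim :: "'a::euclidean_space set \<Rightarrow> ereal" where
  "lower_assouad_dim E = Sup {ereal s | s. 0 \<le> s \<and>
     (\<exists>C>0. \<forall>x\<in>E. \<forall>r R. 0 < r \<and> r < R \<and> ereal R < 2 * ediameter E \<longrightarrow>
        (\<forall>F. finite F \<and> ball_cover E x R r F \<longrightarrow> C * (R / r) powr s \<le> real (card F)))}"

text \<open>Functions on \<open>D\<close> are total functions whose values outside \<open>D\<close> are irrelevant.\<close>

definition C0 :: "'a::euclidean_space set \<Rightarrow> ('a \<Rightarrow> real) set" where
  "C0 D = {u. continuous_on D u \<and>
     compact (closure {x\<in>D. u x \<noteq> 0}) \<and> closure {x\<in>D. u x \<noteq> 0} \<subseteq> D}"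

text \<open>Power with positive exponent on \<open>[0, \<infinity>]\<close>.\<close>

definition ennreal_powr :: "ennreal \<Rightarrow> real \<Rightarrow> ennreal" where
  "ennreal_powr a s = (if a = \<infinity> then \<infinity> else ennreal (enn2real a powr s))"

text \<open>Both sides are evaluated in \<open>[0, \<infinity>]\<close>. On the diagonal the inner integrand is \<open>0 / 0 = 0\<close>,
  which only affects a null set.\<close>

definition fractional_hardy ::
  "real \<Rightarrow> real \<Rightarrow> real \<Rightarrow> 'a::euclidean_space set \<Rightarrow> bool" where
  "fractional_hardy \<delta> q p D \<longleftrightarrow>
     (\<exists>C>0. \<forall>u\<in>C0 D.
        (\<integral>\<^sup>+x\<in>D. ennreal (\<bar>u x\<bar> powr q /
            infdist x (frontier D) powr (q * (\<delta> + real DIM('a) * (1 / q - 1 / p)))) \<partial>lborel)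
        \<le> ennreal C * ennreal_powr
            (\<integral>\<^sup>+x\<in>D. (\<integral>\<^sup>+y\<in>D. ennreal (\<bar>u x - u y\<bar> powr p /
                norm (x - y) powr (real DIM('a) + \<delta> * p)) \<partial>lborel) \<partial>lborel)
            (q / p))"

end

theory Submission
  imports Defs
begin

text \<open>Write \<open>n\<close> for the dimension, \<open>s = \<delta>p\<close>, \<open>d(x)\<close> for the distance of \<open>x\<close> to the boundary and \<open>S\<close> for the
  Gagliardo energy, the double integral of \<open>|u(x) - u(y)|\<^sup>p / |x - y|\<^sup>n\<^sup>+\<^sup>s\<close> over \<open>D \<times> D\<close>. The condition on
  \<open>1/p - 1/q\<close> says \<open>p \<le> q \<le> P\<close> with the Sobolev exponent \<open>P = np/(n - s)\<close>. The integrand on the left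
  is a weighted geometric mean of \<open>|u|\<^sup>p / d\<^sup>s\<close> and \<open>|u|\<^sup>P\<close>, so it is enough to treat the endpoint
  \<open>q = p\<close>, a fractional Hardy inequality, and the endpoint \<open>q = P\<close>, a fractional Sobolev inequality
  (\<open>hardy_sobolev_interpolation\<close>).

  The John condition enters only through corkscrew balls: since \<open>D\<close> is unbounded, a John curve that
  leaves a point for a distant one reaches, at every scale \<open>r\<close>, a point whose distance to the boundary
  is comparable to \<open>r\<close> (\<open>john_domain_corkscrew\<close>).

  For the Sobolev inequality corkscrew balls give \<open>|D \<inter> B(x,r)| \<ge> \<kappa>r\<^sup>n\<close>. Choose \<open>r\<close> so large that,
  by Chebyshev's inequality for \<open>M\<close>, the integral of \<open>|u|\<^sup>P\<close>, the function is below \<open>|u(x)|/2\<close> on half of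
  \<open>D \<inter> B(x,r)\<close>. Then \<open>|u(x) - u(y)|\<close> is at least \<open>|u(x)|/2\<close> there, which bounds \<open>|u(x)|\<^sup>P\<close> by a
  constant times \<open>M\<^sup>s\<^sup>/\<^sup>n\<close> times the inner Gagliardo integral at \<open>x\<close> (\<open>sobolev_pointwise\<close>). Integrating and dividing
  by \<open>M\<^sup>s\<^sup>/\<^sup>n\<close> gives the claim, for \<open>p = 1\<close> as well.

  For the Hardy inequality compare \<open>u(x)\<close> with the values \<open>u(y)\<close> at points \<open>y\<close> whose distance to \<open>x\<close>
  is at most a multiple of \<open>d(x)\<close> and for which \<open>d(y)\<close> lies in \<open>[a d(x), b d(x)]\<close>. The differences are
  controlled by \<open>S\<close>; the values \<open>u(y)\<close> give back the left-hand side with a factor that depends on the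
  geometry, and it can be absorbed as soon as this factor is below \<open>1\<close>, the left-hand side being finite
  for continuous \<open>u\<close> of compact support (\<open>hardy_inequality_of_boundary_pairing\<close>). If the boundary is
  thin, one moves away from it, \<open>d(y)\<close> being about \<open>R d(x)\<close>: by the covering bound few points \<open>x\<close> share
  a given \<open>y\<close>, and the factor is of order \<open>R\<^sup>\<lambda>\<^sup>+\<^sup>s\<^sup>-\<^sup>n\<close> with \<open>\<lambda> < n - s\<close> (\<open>thin_boundary_pairing\<close>). If the
  boundary is thick and unbounded, one moves towards it, \<open>d(y)\<close> being about \<open>d(x)/R\<close>: near \<open>x\<close> there are
  at least about \<open>R\<^sup>\<lambda>\<close> disjoint corkscrew balls of size \<open>d(x)/R\<close>, and the factor is of order
  \<open>R\<^sup>n\<^sup>-\<^sup>s\<^sup>-\<^sup>\<lambda>\<close> with \<open>\<lambda> > n - s\<close> (\<open>thick_boundary_pairing\<close>). In both cases a large \<open>R\<close> makes it small.\<close>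

section \<open>Corkscrew balls in unbounded John domains\<close>

text \<open>The usual corkscrew condition asks for a ball of radius comparable to \<open>r\<close> in \<open>D \<inter> B(x,r)\<close>. Halving
  that ball keeps its points away from the boundary, and the pairings below need this lower bound
  on the distance. Centres \<open>x\<close> on the boundary are included: the thick case uses them.\<close>

definition corkscrew :: "real \<Rightarrow> 'a::euclidean_space set \<Rightarrow> bool" where
  "corkscrew \<kappa> D \<longleftrightarrow> 0 < \<kappa> \<and> \<kappa> \<le> 1 \<and>
     (\<forall>x\<in>closure D. \<forall>r>0. \<exists>w. ball w (\<kappa> * r) \<subseteq> D \<inter> ball x r \<and>
        (\<forall>y\<in>ball w (\<kappa> * r). \<kappa> * r \<le> infdist y (frontier D)))"

lemma corkscrewD:
  assumes "corkscrew \<kappa> D" "x \<in> closure D" "r > 0"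
  shows "\<exists>w. ball w (\<kappa> * r) \<subseteq> D \<inter> ball x r \<and>
    (\<forall>y\<in>ball w (\<kappa> * r). \<kappa> * r \<le> infdist y (frontier D))"
  using assms by (simp add: corkscrew_def)

text \<open>The length of a curve dominates the distance of its end points, as the one-step partition shows.\<close>

lemma dist_le_arc_length:
  assumes "arc_length_parametrized \<gamma> l" "t \<in> {0..l}"
  shows "dist (\<gamma> 0) (\<gamma> t) \<le> t"
proof -
  have "ennreal (dist (\<gamma> 0) (\<gamma> t)) \<le> curve_length \<gamma> 0 t"
    unfolding curve_length_def
    by (rule SUP_upper2[where i = "(1, \<lambda>i. if i = 0 then 0 else t)"]) (use assms(2) in auto)
  also have "\<dots> = ennreal t"
    using assms by (simp add: arc_length_parametrized_def)
  finally show ?thesis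
    using assms(2) by (simp add: ennreal_le_iff)
qed

lemma ball_subset_if_infdist_frontier:
  fixes D :: "'a::euclidean_space set"
  assumes "w \<in> D" "r \<le> infdist w (frontier D)"
  shows "ball w r \<subseteq> D"
proof (rule ccontr)
  assume "\<not> ball w r \<subseteq> D"
  then have ne: "ball w r - D \<noteq> {}"
    by auto
  then have "r > 0"
    using ball_empty[of r w] by (cases "r \<le> 0") auto
  then have "ball w r \<inter> D \<noteq> {}"
    using assms(1) centre_in_ball[of w r] by blast
  with ne obtain z where "z \<in> ball w r" "z \<in> frontier D"
    using connected_Int_frontier[OF connected_ball, of w r D] by blast
  then show False
    using infdist_le[of z "frontier D" w] assms(2) by auto
qed

text \<open>Follow a John curve from a point near \<open>x\<close> towards a point at distance more than \<open>r\<close>, and stop at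
  time \<open>r/4\<close>. At least \<open>3r/4\<close> of the curve is still ahead, so the distance to the boundary is at
  least \<open>r/(4c)\<close>. Only the unboundedness of \<open>D\<close> makes this possible for every \<open>r\<close>.\<close>

lemma john_domain_corkscrew:
  fixes D :: "'a::euclidean_space set"
  assumes "john_domain c D" "c \<ge> 1" "\<not> bounded D"
  shows "corkscrew (1 / (8 * c)) D"
  unfolding corkscrew_def
proof (intro conjI ballI allI impI)
  show "0 < 1 / (8 * c)" "1 / (8 * c) \<le> 1"
    using assms(2) by auto
  fix x and r :: real
  assume x: "x \<in> closure D" and r: "r > 0"
  obtain x1 where x1: "x1 \<in> D" "dist x1 x < r / 2"
    using x r closure_approachable[of x D] half_gt_zero[of r] by blast
  obtain x2 where x2: "x2 \<in> D" "dist x1 x2 > r"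
    using assms(3) unfolding bounded_any_center[of D x1] by (auto simp: not_le)
  obtain \<gamma> l where \<gamma>: "arc_length_parametrized \<gamma> l" "\<gamma> ` {0..l} \<subseteq> D" "\<gamma> 0 = x1" "\<gamma> l = x2"
      "\<And>t. t \<in> {0..l} \<Longrightarrow> infdist (\<gamma> t) (frontier D) \<ge> min t (l - t) / c"
    using conjunct2[OF assms(1)[unfolded john_domain_def], rule_format, OF x1(1) x2(1)]
    by (elim exE conjE) (rule that, assumption+, erule bspec, assumption)
  have "l \<ge> 0"
    using \<gamma>(1) by (simp add: arc_length_parametrized_def)
  then have "l > r"
    using dist_le_arc_length[OF \<gamma>(1), of l] \<gamma>(3,4) x2(2) by auto
  define w where "w = \<gamma> (r / 4)"
  have t: "r / 4 \<in> {0..l}"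
    using r \<open>l > r\<close> by auto
  have w: "w \<in> D" "dist x1 w \<le> r / 4"
    using \<gamma>(2,3) t dist_le_arc_length[OF \<gamma>(1) t] by (auto simp: w_def)
  have "min (r / 4) (l - r / 4) = r / 4"
    using \<open>l > r\<close> r by auto
  then have "r / 4 / c \<le> infdist w (frontier D)"
    using \<gamma>(5)[OF t] unfolding w_def by (simp only:)
  then have dw: "2 * (1 / (8 * c) * r) \<le> infdist w (frontier D)"
    by simp
  have le: "1 / (8 * c) * r \<le> r / 8"
    using assms(2) r by (simp add: field_simps)
  have pos: "1 / (8 * c) * r > 0"
    using assms(2) r by simp
  show "\<exists>w. ball w (1 / (8 * c) * r) \<subseteq> D \<inter> ball x r \<and>
      (\<forall>y\<in>ball w (1 / (8 * c) * r). 1 / (8 * c) * r \<le> infdist y (frontier D))"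
  proof (intro exI conjI ballI subsetI IntI)
    fix y assume y: "y \<in> ball w (1 / (8 * c) * r)"
    then show "y \<in> D"
      using ball_subset_if_infdist_frontier[OF w(1), of "1 / (8 * c) * r"] dw pos by auto
    show "y \<in> ball x r"
      using y w(2) x1(2) le r dist_triangle[of x y x1] dist_triangle[of x1 y w]
      unfolding mem_ball dist_commute[of x x1] by linarith
    show "1 / (8 * c) * r \<le> infdist y (frontier D)"
      using y dw infdist_triangle[of w "frontier D" y] by (simp only: mem_ball)
  qed
qed

lemma corkscrew_measure_density:
  fixes D :: "'a::euclidean_space set"
  assumes "corkscrew \<kappa> D" "x \<in> D" "r > 0" "D \<in> sets borel"
  shows "ennreal (unit_ball_vol (real DIM('a)) * \<kappa> powr real DIM('a) * r powr real DIM('a))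
           \<le> emeasure lborel (D \<inter> ball x r)"
proof -
  obtain w where w: "ball w (\<kappa> * r) \<subseteq> D \<inter> ball x r"
    using assms(1-3) closure_subset[of D] unfolding corkscrew_def by blast
  have "\<kappa> > 0"
    using assms(1) by (simp add: corkscrew_def)
  then have "unit_ball_vol (real DIM('a)) * \<kappa> powr real DIM('a) * r powr real DIM('a)
      = unit_ball_vol (real DIM('a)) * (\<kappa> * r) ^ DIM('a)"
    using assms(3) by (simp add: powr_realpow power_mult_distrib)
  also have "ennreal \<dots> = emeasure lborel (ball w (\<kappa> * r))"
    using \<open>\<kappa> > 0\<close> assms(3) by (simp add: emeasure_ball)
  also have "\<dots> \<le> emeasure lborel (D \<inter> ball x r)"
    by (rule emeasure_mono) (use w assms(4) in auto)
  finally show ?thesis .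
qed

section \<open>Separated sets and decay of powers\<close>

text \<open>By total boundedness the cardinality of a separated subset is bounded, so there is a largest one;
  a point at distance at least \<open>r\<close> from all its members could be added.\<close>

lemma exists_maximal_separated_subset:
  fixes S :: "'a::euclidean_space set"
  assumes "bounded S" "r > 0"
  shows "\<exists>F. finite F \<and> F \<subseteq> S \<and> pairwise (\<lambda>x y. r \<le> dist x y) F \<and> S \<subseteq> (\<Union>z\<in>F. ball z r)"
proof -
  let ?sep = "\<lambda>F. finite F \<and> F \<subseteq> S \<and> pairwise (\<lambda>x y. r \<le> dist x y) F"
  have "compact (closure S)"
    using assms(1) by simp
  then obtain N where N: "finite N" "closure S \<subseteq> (\<Union>z\<in>N. ball z (r / 2))"
    using assms(2) unfolding compact_eq_totally_bounded by (metis half_gt_zero)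
  \<comment> \<open>A ball of radius \<open>r/2\<close> contains at most one point of an \<open>r\<close>-separated set.\<close>
  have card: "card F \<le> card N" if F: "?sep F" for F
  proof -
    have "\<forall>x\<in>F. \<exists>z\<in>N. x \<in> ball z (r / 2)"
      using F N(2) closure_subset[of S] by blast
    then obtain h where h: "\<And>x. x \<in> F \<Longrightarrow> h x \<in> N \<and> x \<in> ball (h x) (r / 2)"
      by metis
    have "inj_on h F"
    proof (rule inj_onI, rule ccontr)
      fix x y assume xy: "x \<in> F" "y \<in> F" "h x = h y" "x \<noteq> y"
      then have "r \<le> dist x y"
        using F by (auto simp: pairwise_def)
      moreover have "dist x y < r"
        using h[OF xy(1)] h[OF xy(2)] xy(3) dist_triangle2[of x y "h x"]
        by (auto simp: dist_commute)
      ultimately show False by simp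
    qed
    then show ?thesis
      using h N(1) by (intro card_inj_on_le[of h]) auto
  qed
  have "\<exists>F. ?sep F \<and> (\<forall>G. ?sep G \<longrightarrow> card G \<le> card F)"
  proof (rule ex_has_greatest_nat[where b = "Suc (card N)"])
    show "?sep {}" by auto
  qed (use card in \<open>auto simp: less_Suc_eq_le\<close>)
  then obtain F where F: "?sep F" "\<And>G. ?sep G \<Longrightarrow> card G \<le> card F"
    by blast
  have "S \<subseteq> (\<Union>z\<in>F. ball z r)"
  proof (rule ccontr)
    assume "\<not> ?thesis"
    then obtain x where x: "x \<in> S" "\<And>z. z \<in> F \<Longrightarrow> r \<le> dist z x"
      by (force simp: not_less)
    then have "x \<notin> F"
      using assms(2) by force
    have "?sep (insert x F)"
      using F(1) x by (auto simp: pairwise_insert dist_commute)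
    from F(2)[OF this] show False
      using \<open>x \<notin> F\<close> F(1) by simp
  qed
  then show ?thesis
    using F(1) by blast
qed

lemma exists_powr_le:
  fixes e \<eta> :: real
  assumes "e < 0" "\<eta> > 0"
  shows "\<exists>R>1. R powr e \<le> \<eta>"
proof -
  have "((\<lambda>R. R powr e) \<longlongrightarrow> 0) at_top"
    using assms(1) by (intro tendsto_neg_powr filterlim_ident)
  then have "\<forall>\<^sub>F R in at_top. R powr e < \<eta> \<and> R > 1"
    using assms(2) order_tendstoD(2) by (intro eventually_conj eventually_gt_at_top) auto
  then show ?thesis
    using eventually_happens'[OF trivial_limit_at_top_linorder, of "\<lambda>R. R powr e < \<eta> \<and> R > 1"]
    by (blast intro: less_imp_le)
qed

section \<open>The fractional Sobolev inequality\<close>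

text \<open>The parameter \<open>s\<close> is the exponent by which the kernel exceeds the dimension, that is \<open>\<delta>p\<close> for
  smoothness \<open>\<delta>\<close>.\<close>

definition gagliardo :: "real \<Rightarrow> real \<Rightarrow> 'a::euclidean_space set \<Rightarrow> ('a \<Rightarrow> real) \<Rightarrow> ennreal" where
  "gagliardo s p D u =
     (\<integral>\<^sup>+x\<in>D. (\<integral>\<^sup>+y\<in>D. ennreal (\<bar>u x - u y\<bar> powr p /
        norm (x - y) powr (real DIM('a) + s)) \<partial>lborel) \<partial>lborel)"

text \<open>The radius \<open>r\<close> is chosen so that the density bound for \<open>D \<inter> B(x,r)\<close> is twice the Chebyshev bound
  \<open>M / a\<^sup>P\<close> for the measure of \<open>{|u| \<ge> a}\<close>, where \<open>a = |u(x)|/2\<close>. On the remaining part \<open>W\<close>, of measure at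
  least \<open>M / a\<^sup>P\<close>, the difference quotient is at least \<open>a\<^sup>p / r\<^sup>n\<^sup>+\<^sup>s\<close>. Since \<open>r\<close> is a power of \<open>M / a\<^sup>P\<close> and
  \<open>p + P s/n = P\<close>, the lower bound for the inner integral is a multiple of \<open>|u(x)|\<^sup>P / M\<^sup>s\<^sup>/\<^sup>n\<close>.\<close>

lemma sobolev_pointwise:
  fixes u :: "'a::euclidean_space \<Rightarrow> real" and D :: "'a set"
  defines "n \<equiv> real DIM('a)"
  assumes D [measurable]: "D \<in> sets borel" and u [measurable]: "u \<in> borel_measurable borel"
    and "\<kappa> > 0" "0 < s" "s < n" "p > 0" "P = n * p / (n - s)"
    and density: "\<And>r. r > 0 \<Longrightarrow> ennreal (\<kappa> * r powr n) \<le> emeasure lborel (D \<inter> ball x r)"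
    and M: "M > 0" "(\<integral>\<^sup>+y\<in>D. ennreal (\<bar>u y\<bar> powr P) \<partial>lborel) = ennreal M"
  shows "ennreal (\<bar>u x\<bar> powr P) \<le> ennreal (2 powr P * (2 / \<kappa>) powr (1 + s / n) * M powr (s / n)) *
     (\<integral>\<^sup>+y\<in>D. ennreal (\<bar>u x - u y\<bar> powr p / norm (x - y) powr (n + s)) \<partial>lborel)"
proof (cases "u x = 0")
  case True
  then show ?thesis by simp
next
  case False
  have n: "n > 0"
    using assms(5,6) by simp
  define a where "a = \<bar>u x\<bar> / 2"
  define r where "r = (2 * M / (\<kappa> * a powr P)) powr (1 / n)"
  have a: "a > 0"
    using False by (simp add: a_def)
  have pos: "2 * M / (\<kappa> * a powr P) > 0"
    using a M(1) \<open>\<kappa> > 0\<close> by simp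
  have r: "r > 0"
    unfolding r_def using a M(1) \<open>\<kappa> > 0\<close> by simp
  have rn: "\<kappa> * r powr n = 2 * (M / a powr P)"
  proof -
    have "r powr n = 2 * M / (\<kappa> * a powr P)"
      using pos n a M(1) \<open>\<kappa> > 0\<close> unfolding r_def powr_powr by simp
    then show ?thesis
      using \<open>\<kappa> > 0\<close> by simp
  qed
  define Z where "Z = {y \<in> D \<inter> ball x r. a \<le> \<bar>u y\<bar>}"
  define W where "W = {y \<in> D \<inter> ball x r. \<bar>u y\<bar> < a}"
  have [measurable]: "Z \<in> sets borel" "W \<in> sets borel"
    unfolding Z_def W_def by measurable
  have "ennreal (a powr P) * emeasure lborel Z = (\<integral>\<^sup>+y. ennreal (a powr P) * indicator Z y \<partial>lborel)"
    by (simp add: nn_integral_cmult_indicator)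
  also have "\<dots> \<le> ennreal M"
    unfolding M(2)[symmetric] using a assms(4-8)
    by (intro nn_integral_mono) (auto simp: Z_def split: split_indicator intro!: ennreal_leI powr_mono2)
  finally have "ennreal (1 / a powr P) * (ennreal (a powr P) * emeasure lborel Z)
      \<le> ennreal (1 / a powr P) * ennreal M"
    by (rule mult_left_mono) simp
  then have Z: "emeasure lborel Z \<le> ennreal (M / a powr P)"
    using a M(1) by (simp add: mult.assoc[symmetric] ennreal_mult'[symmetric])
  have "ennreal (2 * (M / a powr P)) \<le> emeasure lborel (D \<inter> ball x r)"
    using density[OF r] by (simp only: rn)
  also have "\<dots> \<le> emeasure lborel (Z \<union> W)"
    by (rule emeasure_mono) (auto simp: Z_def W_def not_le)
  also have "\<dots> \<le> emeasure lborel Z + emeasure lborel W"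
    by (rule emeasure_subadditive) auto
  also have "\<dots> \<le> ennreal (M / a powr P) + emeasure lborel W"
    using Z by (rule add_right_mono)
  finally have W: "ennreal (M / a powr P) \<le> emeasure lborel W"
    using a M(1)
    by (cases "emeasure lborel W") (auto simp: ennreal_plus[symmetric] simp del: ennreal_plus)
  have "ennreal (a powr p / r powr (n + s) * (M / a powr P))
      \<le> ennreal (a powr p / r powr (n + s)) * emeasure lborel W"
    using W by (subst ennreal_mult') (auto intro!: mult_left_mono)
  also have "\<dots> = (\<integral>\<^sup>+y. ennreal (a powr p / r powr (n + s)) * indicator W y \<partial>lborel)"
    by (simp add: nn_integral_cmult_indicator)
  also have "\<dots> \<le> (\<integral>\<^sup>+y\<in>D. ennreal (\<bar>u x - u y\<bar> powr p / norm (x - y) powr (n + s)) \<partial>lborel)"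
  proof (intro nn_integral_mono)
    fix y
    show "ennreal (a powr p / r powr (n + s)) * indicator W y
      \<le> ennreal (\<bar>u x - u y\<bar> powr p / norm (x - y) powr (n + s)) * indicator D y"
    proof (cases "y \<in> W")
      case True
      then have y: "y \<in> D" "norm (x - y) < r" "a \<le> \<bar>u x - u y\<bar>" "x \<noteq> y"
        using abs_triangle_ineq2[of "u x" "u y"] by (auto simp: W_def a_def dist_norm)
      have "a powr p / r powr (n + s) \<le> \<bar>u x - u y\<bar> powr p / norm (x - y) powr (n + s)"
        using y a assms(5-7) n by (intro frac_le powr_mono2) auto
      then show ?thesis
        using y(1) True by (simp add: ennreal_leI)
    qed simp
  qed
  finally have g: "ennreal (a powr p / r powr (n + s) * (M / a powr P))
      \<le> (\<integral>\<^sup>+y\<in>D. ennreal (\<bar>u x - u y\<bar> powr p / norm (x - y) powr (n + s)) \<partial>lborel)" .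
  have e: "(1 / n) * (n + s) = 1 + s / n"
    using n by (simp add: field_simps)
  have P: "p + P * (s / n) = P"
    using n assms(6,8) by (simp add: field_simps)
  have "r powr (n + s) = (2 * M / (\<kappa> * a powr P)) powr (1 + s / n)"
    unfolding r_def powr_powr e ..
  also have "\<dots> = (2 / \<kappa>) powr (1 + s / n) * M powr (1 + s / n) / a powr (P * (1 + s / n))"
    using a M(1) \<open>\<kappa> > 0\<close> by (simp add: powr_mult powr_divide powr_powr)
  finally have rs: "r powr (n + s) = \<dots>" .
  have "2 powr P * (2 / \<kappa>) powr (1 + s / n) * M powr (s / n) *
      (a powr p / r powr (n + s) * (M / a powr P)) =
      2 powr P * (M powr (s / n) * M / M powr (1 + s / n)) *
        (a powr p * a powr (P * (1 + s / n)) / a powr P)"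
    unfolding rs using a M(1) \<open>\<kappa> > 0\<close> by (simp add: field_simps)
  also have "M powr (s / n) * M / M powr (1 + s / n) = 1"
    using M(1) by (simp add: powr_add)
  also have "a powr p * a powr (P * (1 + s / n)) / a powr P = a powr (p + P * (s / n))"
    using a by (simp add: powr_add distrib_left)
  also have "2 powr P * 1 * a powr (p + P * (s / n)) = \<bar>u x\<bar> powr P"
    unfolding P by (simp add: a_def powr_mult[symmetric])
  finally have "ennreal (\<bar>u x\<bar> powr P) = ennreal (2 powr P * (2 / \<kappa>) powr (1 + s / n) * M powr (s / n)) *
      ennreal (a powr p / r powr (n + s) * (M / a powr P))"
    by (subst ennreal_mult'[symmetric]) auto
  also have "\<dots> \<le> ennreal (2 powr P * (2 / \<kappa>) powr (1 + s / n) * M powr (s / n)) *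
     (\<integral>\<^sup>+y\<in>D. ennreal (\<bar>u x - u y\<bar> powr p / norm (x - y) powr (n + s)) \<partial>lborel)"
    using g by (rule mult_left_mono) simp
  finally show ?thesis .
qed

text \<open>Integrating the pointwise bound gives \<open>M \<le> c M\<^sup>s\<^sup>/\<^sup>n S\<close> for the integral \<open>M\<close> of \<open>|u|\<^sup>P\<close>. As \<open>M\<close> is
  finite, one may divide, and \<open>1 - s/n = p/P\<close>.\<close>

lemma sobolev_inequality:
  fixes u :: "'a::euclidean_space \<Rightarrow> real" and D :: "'a set"
  defines "n \<equiv> real DIM('a)"
  assumes D [measurable]: "D \<in> sets borel" and u [measurable]: "u \<in> borel_measurable borel"
    and "\<kappa> > 0" "0 < s" "s < n" "p > 0" and P: "P = n * p / (n - s)"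
    and density: "\<And>x r. x \<in> D \<Longrightarrow> r > 0 \<Longrightarrow> ennreal (\<kappa> * r powr n) \<le> emeasure lborel (D \<inter> ball x r)"
    and finite: "(\<integral>\<^sup>+y\<in>D. ennreal (\<bar>u y\<bar> powr P) \<partial>lborel) < \<infinity>"
    and S: "gagliardo s p D u = ennreal S" "S \<ge> 0"
  shows "(\<integral>\<^sup>+y\<in>D. ennreal (\<bar>u y\<bar> powr P) \<partial>lborel) \<le>
    ennreal ((2 powr P * (2 / \<kappa>) powr (1 + s / n) * S) powr (P / p))"
proof -
  define M where "M = enn2real (\<integral>\<^sup>+y\<in>D. ennreal (\<bar>u y\<bar> powr P) \<partial>lborel)"
  have M: "(\<integral>\<^sup>+y\<in>D. ennreal (\<bar>u y\<bar> powr P) \<partial>lborel) = ennreal M" "M \<ge> 0"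
    using finite by (auto simp: M_def)
  have n: "n > 0"
    using assms(5,6) by simp
  define c where "c = 2 powr P * (2 / \<kappa>) powr (1 + s / n)"
  have c: "c > 0"
    using \<open>\<kappa> > 0\<close> by (simp add: c_def)
  show ?thesis
  proof (cases "M = 0")
    case True
    then show ?thesis by (simp add: M)
  next
    case False
    then have "M > 0" using M(2) by simp
    have "ennreal M \<le> (\<integral>\<^sup>+x. ennreal (c * M powr (s / n)) * ((\<integral>\<^sup>+y\<in>D. ennreal (\<bar>u x - u y\<bar> powr p /
        norm (x - y) powr (n + s)) \<partial>lborel) * indicator D x) \<partial>lborel)"
      unfolding M(1)[symmetric]
    proof (intro nn_integral_mono)
      fix x
      show "ennreal (\<bar>u x\<bar> powr P) * indicator D x \<le> ennreal (c * M powr (s / n)) *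
          ((\<integral>\<^sup>+y\<in>D. ennreal (\<bar>u x - u y\<bar> powr p / norm (x - y) powr (n + s)) \<partial>lborel) * indicator D x)"
        using sobolev_pointwise[of D u \<kappa> s p P x M] assms \<open>M > 0\<close> M(1)
        by (auto simp: c_def n_def split: split_indicator)
    qed
    also have "\<dots> = ennreal (c * M powr (s / n)) * gagliardo s p D u"
      unfolding gagliardo_def n_def by (rule nn_integral_cmult) measurable
    also have "\<dots> = ennreal (c * M powr (s / n) * S)"
      unfolding S(1) using S(2) c by (simp add: ennreal_mult')
    finally have "M \<le> c * M powr (s / n) * S"
      using S(2) c by (subst (asm) ennreal_le_iff) auto
    then have "M / M powr (s / n) \<le> c * S"
      using \<open>M > 0\<close> by (simp add: field_simps)
    also have "M / M powr (s / n) = M powr (1 - s / n)"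
      using \<open>M > 0\<close> by (simp add: powr_diff)
    finally have "(M powr (1 - s / n)) powr (P / p) \<le> (c * S) powr (P / p)"
      using assms(6-8) n by (intro powr_mono2) auto
    moreover have "(1 - s / n) * (P / p) = 1"
      using assms(6-8) n by (simp add: field_simps)
    ultimately show ?thesis
      using \<open>M > 0\<close> unfolding M(1) powr_powr c_def by (intro ennreal_leI) (simp only: powr_one)
  qed
qed

section \<open>Reducing the fractional Hardy inequality to a pairing of points\<close>

text \<open>The points \<open>y\<close> with which a point \<open>x\<close> is compared. Values \<open>b > 1\<close> allow \<open>y\<close> far from the boundary
  relative to \<open>x\<close>, values \<open>b < 1\<close> force \<open>y\<close> closer to it.\<close>

definition pairing_region :: "real \<Rightarrow> real \<Rightarrow> real \<Rightarrow> 'a::euclidean_space set \<Rightarrow> ('a \<times> 'a) set" where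
  "pairing_region K a b D = {(x, y). x \<in> D \<and> y \<in> D \<and> dist x y < K * infdist x (frontier D) \<and>
     a * infdist x (frontier D) \<le> infdist y (frontier D) \<and>
     infdist y (frontier D) \<le> b * infdist x (frontier D)}"

text \<open>Every \<open>x\<close> has partners of measure at least \<open>m d(x)\<^sup>n\<close>, and every \<open>y\<close> is a partner of a set of
  measure at most \<open>M d(y)\<^sup>n\<close>. The ratio \<open>M/m\<close>, corrected by the change of weight from \<open>x\<close> to \<open>y\<close>, is
  what has to be small.\<close>

definition boundary_pairing ::
  "real \<Rightarrow> real \<Rightarrow> real \<Rightarrow> real \<Rightarrow> real \<Rightarrow> 'a::euclidean_space set \<Rightarrow> bool" where
  "boundary_pairing K a b m M D \<longleftrightarrow> 0 < K \<and> 0 < b \<and> 0 < m \<and> 0 \<le> M \<and>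
     (\<forall>x\<in>D. ennreal (m * infdist x (frontier D) powr real DIM('a))
        \<le> emeasure lborel {y. (x, y) \<in> pairing_region K a b D}) \<and>
     (\<forall>y\<in>D. emeasure lborel {x. (x, y) \<in> pairing_region K a b D}
        \<le> ennreal (M * infdist y (frontier D) powr real DIM('a)))"

lemma borel_measurable_infdist [measurable]:
  "(\<lambda>x::'a::euclidean_space. infdist x A) \<in> borel_measurable borel"
  by (intro borel_measurable_continuous_onI continuous_intros)

lemma sets_pairing_region [measurable]:
  assumes [measurable]: "D \<in> sets borel"
  shows "pairing_region K a b D \<in> sets (borel \<Otimes>\<^sub>M borel)"
proof -
  have "Measurable.pred (borel \<Otimes>\<^sub>M borel) (\<lambda>z. fst z \<in> D \<and> snd z \<in> D \<and>
     dist (fst z) (snd z) < K * infdist (fst z) (frontier D) \<and>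
     a * infdist (fst z) (frontier D) \<le> infdist (snd z) (frontier D) \<and>
     infdist (snd z) (frontier D) \<le> b * infdist (fst z) (frontier D))"
    by measurable
  then show ?thesis
    by (simp add: pred_def space_pair_measure pairing_region_def case_prod_unfold)
qed

lemma infdist_frontier_pos:
  fixes D :: "'a::euclidean_space set"
  assumes "open D" "frontier D \<noteq> {}" "x \<in> D"
  shows "0 < infdist x (frontier D)"
  using assms by (intro infdist_pos_not_in_closed) (auto simp: frontier_def interior_open)

lemma powr_abs_le_split:
  fixes a b :: real
  assumes "p \<ge> 1"
  shows "\<bar>a\<bar> powr p \<le> 2 powr p * (\<bar>a - b\<bar> powr p + \<bar>b\<bar> powr p)"
proof -
  have "\<bar>a\<bar> powr p \<le> (2 * max \<bar>a - b\<bar> \<bar>b\<bar>) powr p"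
    using assms abs_triangle_ineq[of "a - b" b] by (intro powr_mono2) (auto simp: max_def)
  also have "\<dots> = 2 powr p * max \<bar>a - b\<bar> \<bar>b\<bar> powr p"
    by (simp add: powr_mult)
  also have "\<dots> \<le> 2 powr p * (\<bar>a - b\<bar> powr p + \<bar>b\<bar> powr p)"
    by (intro mult_left_mono) (auto simp: max_def)
  finally show ?thesis .
qed

text \<open>On the pairing region the weight \<open>d(x)\<^sup>-\<^sup>c\<close> is at most \<open>K\<^sup>c |x - y|\<^sup>-\<^sup>c\<close> and at most \<open>b\<^sup>c d(y)\<^sup>-\<^sup>c\<close>; the
  first bound suits \<open>u(x) - u(y)\<close>, the second \<open>u(y)\<close>. For \<open>x = y\<close> the quotient vanishes by convention,
  as does the difference.\<close>

lemma hardy_pointwise: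
  fixes x y :: "'a::euclidean_space" and u :: "'a \<Rightarrow> real"
  assumes "p \<ge> 1" "c > 0" "K > 0" "b > 0"
    and d: "0 < infdist x (frontier D)" "0 < infdist y (frontier D)"
    and xy: "(x, y) \<in> pairing_region K a b D"
  shows "\<bar>u x\<bar> powr p / infdist x (frontier D) powr c
     \<le> 2 powr p * K powr c * (\<bar>u x - u y\<bar> powr p / norm (x - y) powr c)
       + 2 powr p * b powr c * (\<bar>u y\<bar> powr p / infdist y (frontier D) powr c)"
proof -
  let ?d = "\<lambda>x. infdist x (frontier D)"
  have *: "dist x y < K * ?d x" "?d y \<le> b * ?d x"
    using xy by (auto simp: pairing_region_def)
  have "\<bar>u x\<bar> powr p / ?d x powr c \<le> 2 powr p * (\<bar>u x - u y\<bar> powr p + \<bar>u y\<bar> powr p) / ?d x powr c"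
    using assms(1) by (intro divide_right_mono powr_abs_le_split) auto
  also have "\<dots> = 2 powr p * (\<bar>u x - u y\<bar> powr p / ?d x powr c) + 2 powr p * (\<bar>u y\<bar> powr p / ?d x powr c)"
    by (simp add: distrib_left add_divide_distrib)
  also have "\<bar>u x - u y\<bar> powr p / ?d x powr c \<le> K powr c * (\<bar>u x - u y\<bar> powr p / norm (x - y) powr c)"
  proof (cases "x = y")
    case False
    have "norm (x - y) powr c \<le> (K * ?d x) powr c"
      using *(1) assms(2) by (intro powr_mono2) (auto simp: dist_norm)
    then have "norm (x - y) powr c \<le> K powr c * ?d x powr c"
      using assms(3) d by (simp add: powr_mult)
    then have "\<bar>u x - u y\<bar> powr p * norm (x - y) powr c \<le> \<bar>u x - u y\<bar> powr p * (K powr c * ?d x powr c)"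
      by (intro mult_left_mono) auto
    then show ?thesis
      using False d by (simp add: field_simps)
  qed simp
  also have "\<bar>u y\<bar> powr p / ?d x powr c \<le> b powr c * (\<bar>u y\<bar> powr p / ?d y powr c)"
  proof -
    have "?d y powr c \<le> (b * ?d x) powr c"
      using *(2) assms(2) d by (intro powr_mono2) auto
    then have "?d y powr c \<le> b powr c * ?d x powr c"
      using assms(4) d by (simp add: powr_mult)
    then have "\<bar>u y\<bar> powr p * ?d y powr c \<le> \<bar>u y\<bar> powr p * (b powr c * ?d x powr c)"
      by (intro mult_left_mono) auto
    then show ?thesis
      using d by (simp add: field_simps)
  qed
  finally show ?thesis
    by (simp add: mult.assoc)
qed

text \<open>Integrate the pointwise inequality with exponent \<open>n + s\<close> over all pairs in the region. On the left
  the partners of \<open>x\<close> contribute the factor \<open>m d(x)\<^sup>n\<close>, which turns \<open>d(x)\<^sup>-\<^sup>n\<^sup>-\<^sup>s\<close> into \<open>d(x)\<^sup>-\<^sup>s\<close>. On the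
  right, after exchanging the integrals, the points paired with \<open>y\<close> contribute at most \<open>M d(y)\<^sup>n\<close>. So
  the left-hand side \<open>H\<close> satisfies \<open>m H \<le> 2\<^sup>p K\<^sup>n\<^sup>+\<^sup>s S + (m/2) H\<close>, and being finite it can be absorbed.\<close>

lemma hardy_inequality_of_boundary_pairing:
  fixes u :: "'a::euclidean_space \<Rightarrow> real" and D :: "'a set"
  defines "n \<equiv> real DIM('a)" and "d \<equiv> \<lambda>x. infdist x (frontier D)"
  assumes D: "open D" "frontier D \<noteq> {}" and u [measurable]: "u \<in> borel_measurable borel"
    and "p \<ge> 1" "s > 0"
    and pairing: "boundary_pairing K a b m M D"
    and small: "2 powr (p + 1) * (M * b powr (n + s)) \<le> m"
    and finite: "(\<integral>\<^sup>+x\<in>D. ennreal (\<bar>u x\<bar> powr p / d x powr s) \<partial>lborel) < \<infinity>"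
  shows "(\<integral>\<^sup>+x\<in>D. ennreal (\<bar>u x\<bar> powr p / d x powr s) \<partial>lborel)
     \<le> ennreal (2 powr (p + 1) * K powr (n + s) / m) * gagliardo s p D u"
proof -
  let ?G = "pairing_region K a b D"
  let ?c1 = "2 powr p * K powr (n + s)" and ?c2 = "2 powr p * b powr (n + s)"
  define H where "H = (\<integral>\<^sup>+x\<in>D. ennreal (\<bar>u x\<bar> powr p / d x powr s) \<partial>lborel)"
  have [measurable]: "D \<in> sets borel"
    using D(1) by simp
  have [measurable]: "d \<in> borel_measurable borel"
    unfolding d_def by measurable
  note sets_pairing_region[measurable]
  have G1: "{y. (x, y) \<in> ?G} \<in> sets borel" and G2: "{y. (y, x) \<in> ?G} \<in> sets borel" for x
    by measurable
  have d: "d x > 0" if "x \<in> D" for x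
    using infdist_frontier_pos[OF D that] by (simp add: d_def)
  have c: "K > 0" "b > 0" "m > 0" "M \<ge> 0"
    and m: "\<And>x. x \<in> D \<Longrightarrow> ennreal (m * d x powr n) \<le> emeasure lborel {y. (x, y) \<in> ?G}"
    and M: "\<And>y. y \<in> D \<Longrightarrow> emeasure lborel {x. (x, y) \<in> ?G} \<le> ennreal (M * d y powr n)"
    using pairing by (auto simp: boundary_pairing_def n_def d_def)
  have n: "n > 0" by (simp add: n_def)
  let ?k = "\<lambda>x y. \<bar>u x - u y\<bar> powr p / norm (x - y) powr (n + s)"
  let ?h = "\<lambda>y. \<bar>u y\<bar> powr p / d y powr (n + s)"
  have "ennreal m * H = (\<integral>\<^sup>+x. ennreal m * (ennreal (\<bar>u x\<bar> powr p / d x powr s) * indicator D x) \<partial>lborel)"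
    unfolding H_def by (rule nn_integral_cmult[symmetric]) measurable
  also have "\<dots> \<le> (\<integral>\<^sup>+x. (\<integral>\<^sup>+y. ennreal (?h x) * indicator ?G (x, y) \<partial>lborel) \<partial>lborel)"
  proof (intro nn_integral_mono)
    fix x
    show "ennreal m * (ennreal (\<bar>u x\<bar> powr p / d x powr s) * indicator D x)
       \<le> (\<integral>\<^sup>+y. ennreal (?h x) * indicator ?G (x, y) \<partial>lborel)"
    proof (cases "x \<in> D")
      case True
      have "m * (\<bar>u x\<bar> powr p / d x powr s) = ?h x * (m * d x powr n)"
        using d[OF True] by (simp add: powr_add)
      then have "ennreal m * ennreal (\<bar>u x\<bar> powr p / d x powr s) = ennreal (?h x) * ennreal (m * d x powr n)"
        using c by (simp add: ennreal_mult'[symmetric] ennreal_mult''[symmetric])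
      also have "\<dots> \<le> ennreal (?h x) * emeasure lborel {y. (x, y) \<in> ?G}"
        by (intro mult_left_mono m True) simp
      also have "\<dots> = (\<integral>\<^sup>+y. ennreal (?h x) * indicator {y. (x, y) \<in> ?G} y \<partial>lborel)"
        using G1 by (simp add: nn_integral_cmult_indicator)
      finally show ?thesis
        using True by (simp add: indicator_def)
    qed simp
  qed
  also have "\<dots> \<le> (\<integral>\<^sup>+x. (\<integral>\<^sup>+y. ennreal (?c1 * ?k x y) * indicator ?G (x, y)
       + ennreal (?c2 * ?h y) * indicator ?G (x, y) \<partial>lborel) \<partial>lborel)"
  proof (intro nn_integral_mono)
    fix x y
    show "ennreal (?h x) * indicator ?G (x, y) \<le> ennreal (?c1 * ?k x y) * indicator ?G (x, y)
       + ennreal (?c2 * ?h y) * indicator ?G (x, y)"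
    proof (cases "(x, y) \<in> ?G")
      case True
      then have "x \<in> D" "y \<in> D"
        by (auto simp: pairing_region_def)
      then show ?thesis
        using hardy_pointwise[OF _ _ c(1,2) _ _ True, of p "n + s" u] \<open>p \<ge> 1\<close> \<open>s > 0\<close> n d True
        by (simp add: ennreal_plus[symmetric] d_def del: ennreal_plus)
    qed simp
  qed
  also have "\<dots> = (\<integral>\<^sup>+x. (\<integral>\<^sup>+y. ennreal (?c1 * ?k x y) * indicator ?G (x, y) \<partial>lborel)
      + (\<integral>\<^sup>+y. ennreal (?c2 * ?h y) * indicator ?G (x, y) \<partial>lborel) \<partial>lborel)"
    by (intro nn_integral_cong nn_integral_add) measurable
  also have "\<dots> = (\<integral>\<^sup>+x. (\<integral>\<^sup>+y. ennreal (?c1 * ?k x y) * indicator ?G (x, y) \<partial>lborel) \<partial>lborel)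
      + (\<integral>\<^sup>+x. (\<integral>\<^sup>+y. ennreal (?c2 * ?h y) * indicator ?G (x, y) \<partial>lborel) \<partial>lborel)"
    by (intro nn_integral_add) measurable
  also have "(\<integral>\<^sup>+x. (\<integral>\<^sup>+y. ennreal (?c1 * ?k x y) * indicator ?G (x, y) \<partial>lborel) \<partial>lborel)
      \<le> (\<integral>\<^sup>+x. (\<integral>\<^sup>+y. ennreal ?c1 * (ennreal (?k x y) * indicator D y * indicator D x) \<partial>lborel) \<partial>lborel)"
    by (intro nn_integral_mono)
       (auto simp: pairing_region_def ennreal_mult'[symmetric] split: split_indicator)
  also have "\<dots> = ennreal ?c1 * gagliardo s p D u"
    unfolding gagliardo_def n_def[symmetric]
    by (simp add: nn_integral_cmult nn_integral_multc)
  also have "(\<integral>\<^sup>+x. (\<integral>\<^sup>+y. ennreal (?c2 * ?h y) * indicator ?G (x, y) \<partial>lborel) \<partial>lborel)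
      = (\<integral>\<^sup>+y. (\<integral>\<^sup>+x. ennreal (?c2 * ?h y) * indicator ?G (x, y) \<partial>lborel) \<partial>lborel)"
    by (rule lborel_pair.Fubini'[symmetric]) measurable
  also have "\<dots> \<le> (\<integral>\<^sup>+y. ennreal (?c2 * M) * (ennreal (\<bar>u y\<bar> powr p / d y powr s) * indicator D y) \<partial>lborel)"
  proof (intro nn_integral_mono)
    fix y
    have "(\<integral>\<^sup>+x. ennreal (?c2 * ?h y) * indicator ?G (x, y) \<partial>lborel)
        = (\<integral>\<^sup>+x. ennreal (?c2 * ?h y) * indicator {x. (x, y) \<in> ?G} x \<partial>lborel)"
      by (simp add: indicator_def)
    also have "\<dots> = ennreal (?c2 * ?h y) * emeasure lborel {x. (x, y) \<in> ?G}"
      using G2 by (simp add: nn_integral_cmult_indicator)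
    also have "\<dots> \<le> ennreal (?c2 * M) * (ennreal (\<bar>u y\<bar> powr p / d y powr s) * indicator D y)"
    proof (cases "y \<in> D")
      case True
      have "ennreal (?c2 * ?h y) * emeasure lborel {x. (x, y) \<in> ?G} \<le> ennreal (?c2 * ?h y) * ennreal (M * d y powr n)"
        by (intro mult_left_mono M True) simp
      also have "\<dots> = ennreal (?c2 * ?h y * (M * d y powr n))"
        using c by (intro ennreal_mult''[symmetric]) simp
      also have "?c2 * ?h y * (M * d y powr n) = ?c2 * M * (\<bar>u y\<bar> powr p / d y powr s)"
        using d[OF True] by (simp add: powr_add)
      also have "ennreal \<dots> = ennreal (?c2 * M) * ennreal (\<bar>u y\<bar> powr p / d y powr s)"
        by (intro ennreal_mult'') simp
      finally show ?thesis
        using True by simp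
    next
      case False
      then have "{x. (x, y) \<in> ?G} = {}"
        by (auto simp: pairing_region_def)
      then show ?thesis by simp
    qed
    finally show "(\<integral>\<^sup>+x. ennreal (?c2 * ?h y) * indicator ?G (x, y) \<partial>lborel)
      \<le> ennreal (?c2 * M) * (ennreal (\<bar>u y\<bar> powr p / d y powr s) * indicator D y)" .
  qed
  also have "\<dots> = ennreal (?c2 * M) * H"
    unfolding H_def by (rule nn_integral_cmult) measurable
  finally have main: "ennreal m * H \<le> ennreal ?c1 * gagliardo s p D u + ennreal (?c2 * M) * H"
    by simp
  show ?thesis
  proof (cases "gagliardo s p D u")
    case top
    then show ?thesis
      using c by (simp add: ennreal_mult_top)
  next
    case (real S)
    obtain h where h: "H = ennreal h" "h \<ge> 0"
      using finite by (cases H) (auto simp: H_def)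
    have "m * h \<le> ?c1 * S + ?c2 * M * h"
      using main c real h
      by (simp add: ennreal_mult'[symmetric] ennreal_mult''[symmetric] ennreal_plus[symmetric] ennreal_le_iff
          del: ennreal_plus)
    moreover have "?c2 * M * h \<le> m / 2 * h"
      using small h(2) by (intro mult_right_mono) (auto simp: powr_add mult_ac)
    ultimately have "m / 2 * h \<le> ?c1 * S"
      by simp
    then have "h \<le> 2 powr (p + 1) * K powr (n + s) / m * S"
      using c by (simp add: field_simps powr_add)
    then show ?thesis
      using c real h unfolding H_def[symmetric]
      by (simp add: ennreal_mult'[symmetric] ennreal_mult''[symmetric] ennreal_leI)
  qed
qed

section \<open>Covering bounds from the Assouad dimensions\<close>

lemma emeasure_ball_powr:
  fixes c :: "'a::euclidean_space"
  assumes "r > 0"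
  shows "emeasure lborel (ball c r) = ennreal (unit_ball_vol (real DIM('a)) * r powr real DIM('a))"
  using assms by (simp add: emeasure_ball powr_realpow)

lemma dist_le_ediameter:
  assumes "x \<in> E" "y \<in> E"
  shows "ereal (dist x y) \<le> ediameter E"
  unfolding ediameter_def using assms by (blast intro: SUP_upper2)

lemma ediameter_unbounded:
  assumes "\<not> bounded E"
  shows "ediameter E = \<infinity>"
proof (rule ereal_top)
  fix B
  obtain x where x: "x \<in> E"
    using assms by fastforce
  obtain y where "y \<in> E" "dist x y > B"
    using assms unfolding bounded_any_center[of E x] by (auto simp: not_le)
  then show "ereal B \<le> ediameter E"
    using dist_le_ediameter[OF x] order_trans[of "ereal B" "ereal (dist x y)"] by simp
qed

text \<open>The definition restricts the radii to \<open>R < 2 diam E\<close>; here the bound is extended to all \<open>R\<close>. For larger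
  \<open>R\<close> the ball of radius \<open>3/2 diam E\<close> already contains \<open>E\<close>, and if \<open>r\<close> is at least this number, one ball
  suffices. The single-ball case costs the constant \<open>max C 1\<close>; it includes singletons.\<close>

lemma upper_assouad_dim_cover:
  fixes E :: "'a::euclidean_space set"
  assumes "upper_assouad_dim E < ereal t"
  shows "\<exists>l C. 0 \<le> l \<and> l < t \<and> 0 < C \<and>
    (\<forall>x\<in>E. \<forall>r R. 0 < r \<and> r < R \<longrightarrow>
       (\<exists>F. finite F \<and> ball_cover E x R r F \<and> real (card F) \<le> C * (R / r) powr l))"
proof -
  have *: "\<exists>l. 0 \<le> l \<and> l < t \<and> P l" if "Inf {ereal l |l. 0 \<le> l \<and> P l} < ereal t" for P
    using that by (auto simp: Inf_less_iff)
  obtain l where "0 \<le> l" "l < t"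
    and ex: "\<exists>C>0. \<forall>x\<in>E. \<forall>r R. 0 < r \<and> r < R \<and> ereal R < 2 * ediameter E \<longrightarrow>
        (\<exists>F. finite F \<and> ball_cover E x R r F \<and> real (card F) \<le> C * (R / r) powr l)"
    using *[OF assms[unfolded upper_assouad_dim_def]] by blast
  from ex obtain C where "C > 0"
    and cover: "\<And>x r R. x \<in> E \<Longrightarrow> 0 < r \<Longrightarrow> r < R \<Longrightarrow> ereal R < 2 * ediameter E \<Longrightarrow>
        \<exists>F. finite F \<and> ball_cover E x R r F \<and> real (card F) \<le> C * (R / r) powr l"
    by (elim exE conjE) (rule that, assumption, blast)
  note l = \<open>0 \<le> l\<close> \<open>l < t\<close> \<open>C > 0\<close>
  have "\<exists>F. finite F \<and> ball_cover E x R r F \<and> real (card F) \<le> max C 1 * (R / r) powr l"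
    if x: "x \<in> E" and r: "0 < r" "r < R" for x r R
  proof (cases "ereal R < 2 * ediameter E")
    case True
    then obtain F where F: "finite F" "ball_cover E x R r F" "real (card F) \<le> C * (R / r) powr l"
      using cover[OF x r] by blast
    moreover have "C * (R / r) powr l \<le> max C 1 * (R / r) powr l"
      by (intro mult_right_mono) auto
    ultimately show ?thesis
      by (metis order_trans)
  next
    case False
    obtain \<Delta> where \<Delta>: "ediameter E = ereal \<Delta>" "\<Delta> \<ge> 0" "2 * \<Delta> \<le> R"
      using False dist_le_ediameter[OF x x] by (cases "ediameter E") auto
    have E: "dist x y \<le> \<Delta>" if "y \<in> E" for y
      using dist_le_ediameter[OF x that] \<Delta>(1) by simp
    show ?thesis
    proof (cases "r < 3 / 2 * \<Delta>")
      case True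
      then obtain F where F: "finite F" "ball_cover E x (3 / 2 * \<Delta>) r F"
          "real (card F) \<le> C * ((3 / 2 * \<Delta>) / r) powr l"
        using cover[OF x r(1), of "3 / 2 * \<Delta>"] \<Delta>(1) r(1) by auto
      have "ball_cover E x R r F"
        using F(2) E True r(1) unfolding ball_cover_def by (force simp: mem_ball)
      moreover have "C * ((3 / 2 * \<Delta>) / r) powr l \<le> max C 1 * (R / r) powr l"
        using r True \<Delta> l by (intro mult_mono powr_mono2 divide_right_mono) auto
      ultimately show ?thesis
        using F(1,3) by (metis order_trans)
    next
      case False
      have "ball_cover E x R r {x}"
        using E False r(1) x \<Delta>(2) unfolding ball_cover_def by (force simp: mem_ball)
      moreover have "1 * 1 \<le> max C 1 * (R / r) powr l"
        using r l by (intro mult_mono ge_one_powr_ge_zero) auto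
      ultimately show ?thesis
        by (intro exI[of _ "{x}"]) auto
    qed
  qed
  then show ?thesis
    using l by (intro exI[of _ l] exI[of _ "max C 1"]) auto
qed

text \<open>In an unbounded set all radii are admissible, so the bound holds at every scale.\<close>

lemma lower_assouad_dim_cover:
  fixes E :: "'a::euclidean_space set"
  assumes "ereal t < lower_assouad_dim E" "\<not> bounded E"
  shows "\<exists>l C. t < l \<and> 0 < C \<and>
    (\<forall>x\<in>E. \<forall>r R. 0 < r \<and> r < R \<longrightarrow>
       (\<forall>F. finite F \<and> ball_cover E x R r F \<longrightarrow> C * (R / r) powr l \<le> real (card F)))"
  using assms(1) unfolding lower_assouad_dim_def less_Sup_iff ediameter_unbounded[OF assms(2)]
  by auto

section \<open>Pairings for thin and for thick boundaries\<close>

text \<open>A corkscrew ball in \<open>D \<inter> B(x, R d(x))\<close> provides the partners of \<open>x\<close>: \<open>m\<close> is a multiple of \<open>R\<^sup>n\<close>.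
  Conversely, the \<open>x\<close> paired with \<open>y\<close> have \<open>d(x) \<le> \<rho>\<close> with \<open>\<rho> = d(y)/(\<kappa>R)\<close> and lie within \<open>d(y)/\<kappa>\<close> of
  \<open>y\<close>, so they are covered by the doubled balls of a cover of a boundary piece of size \<open>4d(y)/\<kappa>\<close> by balls of
  radius \<open>\<rho>\<close>. There are at most a multiple of \<open>R\<^sup>\<lambda>\<close> of them, and \<open>M\<close> is a multiple of \<open>R\<^sup>\<lambda>\<^sup>-\<^sup>n\<close>. With
  \<open>b = 2R\<close> the quotient \<open>M b\<^sup>n\<^sup>+\<^sup>s / m\<close> equals \<open>Q R\<^sup>\<lambda>\<^sup>+\<^sup>s\<^sup>-\<^sup>n\<close>.\<close>

lemma thin_boundary_pairing:
  fixes D :: "'a::euclidean_space set"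
  defines "n \<equiv> real DIM('a)"
  assumes D: "open D" "frontier D \<noteq> {}" and \<kappa>: "corkscrew \<kappa> D"
    and dim: "upper_assouad_dim (frontier D) < ereal (n - s)" and "\<eta> > 0"
  shows "\<exists>K a b m M. boundary_pairing K a b m M D \<and> M * b powr (n + s) \<le> \<eta> * m"
proof -
  define d where "d = (\<lambda>x. infdist x (frontier D))"
  define \<omega> where "\<omega> = unit_ball_vol n"
  have \<omega>: "\<omega> > 0"
    by (simp add: \<omega>_def n_def)
  have d: "d x > 0" if "x \<in> D" for x
    using infdist_frontier_pos[OF D that] by (simp add: d_def)
  have \<kappa>01: "0 < \<kappa>" "\<kappa> \<le> 1"
    using \<kappa> by (auto simp: corkscrew_def)
  obtain l C where l: "0 \<le> l" "l < n - s" "C > 0"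
    and cover: "\<And>x r R. x \<in> frontier D \<Longrightarrow> 0 < r \<Longrightarrow> r < R \<Longrightarrow>
        \<exists>F. finite F \<and> ball_cover (frontier D) x R r F \<and> real (card F) \<le> C * (R / r) powr l"
    using upper_assouad_dim_cover[OF dim] by auto
  \<comment> \<open>The part of \<open>M b\<^sup>n\<^sup>+\<^sup>s / m\<close> that does not depend on \<open>R\<close>.\<close>
  define Q where "Q = C * 4 powr l * 2 powr n * 2 powr (n + s) / (\<kappa> powr n * \<kappa> powr n)"
  have Q: "Q > 0"
    using l \<kappa>01 by (simp add: Q_def)
  obtain R where R: "R > 1" "R powr (l + s - n) \<le> \<eta> / Q"
    using exists_powr_le[of "l + s - n" "\<eta> / Q"] l Q \<open>\<eta> > 0\<close> by auto
  define m where "m = \<omega> * (\<kappa> * R) powr n"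
  define M where "M = C * (4 * R) powr l * (\<omega> * (2 / (\<kappa> * R)) powr n)"
  have m: "m > 0"
    using \<omega> \<kappa>01 R by (simp add: m_def)
  have "M * (2 * R) powr (n + s) = m * (Q * R powr (l + s - n))"
    using \<kappa>01 R \<omega> unfolding M_def m_def Q_def
    by (simp add: powr_mult powr_divide powr_add powr_diff)
  also have "\<dots> \<le> m * \<eta>"
    using R(2) Q m by (intro mult_left_mono) (auto simp: field_simps)
  finally have small: "M * (2 * R) powr (n + s) \<le> \<eta> * m"
    by (simp add: mult.commute)
  let ?G = "pairing_region R (\<kappa> * R) (2 * R) D"
  have "?G \<in> sets (borel \<Otimes>\<^sub>M borel)"
    using D(1) by (intro sets_pairing_region) auto
  note [measurable] = this
  have meas: "{y. (x, y) \<in> ?G} \<in> sets borel" for x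
    by measurable
  have "boundary_pairing R (\<kappa> * R) (2 * R) m M D"
    unfolding boundary_pairing_def d_def[symmetric, THEN fun_cong] n_def[symmetric]
  proof (intro conjI ballI)
    show "0 < R" "0 < 2 * R" "0 < m" "0 \<le> M"
      using R m l \<omega> by (auto simp: M_def)
  next
    fix x assume x: "x \<in> D"
    have "0 < R * d x"
      using R d[OF x] by simp
    moreover have "x \<in> closure D"
      using x closure_subset by blast
    ultimately obtain w where w: "ball w (\<kappa> * (R * d x)) \<subseteq> D \<inter> ball x (R * d x)"
        "\<And>y. y \<in> ball w (\<kappa> * (R * d x)) \<Longrightarrow> \<kappa> * (R * d x) \<le> d y"
      using corkscrewD[OF \<kappa>] unfolding d_def by metis
    have "ball w (\<kappa> * (R * d x)) \<subseteq> {y. (x, y) \<in> ?G}"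
    proof
      fix y assume y: "y \<in> ball w (\<kappa> * (R * d x))"
      then have "y \<in> D" "dist x y < R * d x" "\<kappa> * R * d x \<le> d y"
        using w by (auto simp: mult.assoc)
      moreover have "d y \<le> d x + dist y x"
        unfolding d_def by (rule infdist_triangle)
      moreover have "1 * d x \<le> R * d x"
        using R d[OF x] by (intro mult_right_mono) auto
      ultimately show "y \<in> {y. (x, y) \<in> ?G}"
        using x by (auto simp: pairing_region_def d_def dist_commute)
    qed
    then have "emeasure lborel (ball w (\<kappa> * (R * d x))) \<le> emeasure lborel {y. (x, y) \<in> ?G}"
      using meas by (intro emeasure_mono) auto
    then show "ennreal (m * d x powr n) \<le> emeasure lborel {y. (x, y) \<in> ?G}"
      using \<kappa>01 R d[OF x]
      by (simp add: emeasure_ball_powr m_def powr_mult \<omega>_def n_def mult_ac)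
  next
    fix y assume y: "y \<in> D"
    define \<rho> where "\<rho> = d y / (\<kappa> * R)"
    have dy: "d y > 0" by (rule d[OF y])
    have \<rho>: "\<rho> > 0" "\<rho> \<le> d y / \<kappa>" "d y \<le> d y / \<kappa>"
      using dy R \<kappa>01 by (auto simp: \<rho>_def field_simps)
    obtain z0 where z0: "z0 \<in> frontier D" "d y = dist y z0"
      using infdist_attains_inf[OF frontier_closed D(2)] unfolding d_def by metis
    have ratio: "4 * (d y / \<kappa>) / \<rho> = 4 * R"
      using dy R \<kappa>01 by (simp add: \<rho>_def)
    obtain F where F: "finite F" "ball_cover (frontier D) z0 (4 * (d y / \<kappa>)) \<rho> F"
        "real (card F) \<le> C * (4 * R) powr l"
      using cover[OF z0(1) \<rho>(1), of "4 * (d y / \<kappa>)"] \<rho> unfolding ratio by auto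
    have "{x. (x, y) \<in> ?G} \<subseteq> (\<Union>z\<in>F. ball z (2 * \<rho>))"
    proof
      fix x assume "x \<in> {x. (x, y) \<in> ?G}"
      then have x: "dist x y < R * d x" "\<kappa> * R * d x \<le> d y"
        by (auto simp: pairing_region_def d_def)
      then have dx: "d x \<le> \<rho>" "R * d x \<le> d y / \<kappa>"
        using R \<kappa>01 by (auto simp: \<rho>_def field_simps)
      obtain z where z: "z \<in> frontier D" "d x = dist x z"
        using infdist_attains_inf[OF frontier_closed D(2)] unfolding d_def by metis
      have "dist z0 z < 4 * (d y / \<kappa>)"
        using dist_triangle[of z0 z y] dist_triangle[of y z x] z z0 x(1) dx \<rho>
        unfolding dist_commute[of z0 y] dist_commute[of y x] by linarith
      then obtain v where v: "v \<in> F" "dist v z < \<rho>"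
        using F(2) z(1) unfolding ball_cover_def by fastforce
      then have "dist v x < 2 * \<rho>"
        using dist_triangle[of v x z] z(2) dx(1) by (simp add: dist_commute)
      then show "x \<in> (\<Union>z\<in>F. ball z (2 * \<rho>))"
        using v(1) by auto
    qed
    then have "emeasure lborel {x. (x, y) \<in> ?G} \<le> emeasure lborel (\<Union>z\<in>F. ball z (2 * \<rho>))"
      using F(1) by (intro emeasure_mono) auto
    also have "\<dots> \<le> (\<Sum>z\<in>F. emeasure lborel (ball z (2 * \<rho>)))"
      using F(1) by (intro emeasure_subadditive_finite) auto
    also have "\<dots> = ennreal (real (card F) * (\<omega> * (2 * \<rho>) powr n))"
      using \<rho>(1) \<omega> by (simp add: emeasure_ball_powr \<omega>_def n_def ennreal_mult' ennreal_of_nat_eq_real_of_nat)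
    also have "\<dots> \<le> ennreal (C * (4 * R) powr l * (\<omega> * (2 * \<rho>) powr n))"
      using F(3) \<omega> by (intro ennreal_leI mult_right_mono) auto
    also have "C * (4 * R) powr l * (\<omega> * (2 * \<rho>) powr n) = M * d y powr n"
      using dy R \<kappa>01 by (simp add: M_def \<rho>_def powr_mult powr_divide)
    finally show "emeasure lborel {x. (x, y) \<in> ?G} \<le> ennreal (M * d y powr n)" .
  qed
  with small show ?thesis by blast
qed

text \<open>Let \<open>z\<^sub>0\<close> be a boundary point closest to \<open>x\<close>. A maximal \<open>d(x)/R\<close>-separated subset of the boundary in
  \<open>B(z\<^sub>0, d(x))\<close> gives a cover by balls of this radius, so it has at least a multiple of \<open>R\<^sup>\<lambda>\<close> points.
  Corkscrew balls in the disjoint balls of half the radius about them provide the partners of \<open>x\<close>, and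
  \<open>m\<close> is a multiple of \<open>R\<^sup>\<lambda>\<^sup>-\<^sup>n\<close>. For \<open>M\<close> the trivial bound by a ball of radius \<open>6R d(y)/\<kappa>\<close> is
  enough. With \<open>b = 1/(2R)\<close> the quotient \<open>M b\<^sup>n\<^sup>+\<^sup>s / m\<close> equals \<open>Q R\<^sup>n\<^sup>-\<^sup>s\<^sup>-\<^sup>\<lambda>\<close>.\<close>

lemma thick_boundary_pairing:
  fixes D :: "'a::euclidean_space set"
  defines "n \<equiv> real DIM('a)"
  assumes D: "open D" "frontier D \<noteq> {}" and \<kappa>: "corkscrew \<kappa> D"
    and dim: "ereal (n - s) < lower_assouad_dim (frontier D)" "\<not> bounded (frontier D)"
    and "\<eta> > 0"
  shows "\<exists>K a b m M. boundary_pairing K a b m M D \<and> M * b powr (n + s) \<le> \<eta> * m"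
proof -
  define d where "d = (\<lambda>x. infdist x (frontier D))"
  define \<omega> where "\<omega> = unit_ball_vol n"
  have \<omega>: "\<omega> > 0"
    by (simp add: \<omega>_def n_def)
  have d: "d x > 0" if "x \<in> D" for x
    using infdist_frontier_pos[OF D that] by (simp add: d_def)
  have \<kappa>01: "0 < \<kappa>" "\<kappa> \<le> 1"
    using \<kappa> by (auto simp: corkscrew_def)
  obtain l C where l: "n - s < l" "C > 0"
    and cover: "\<And>x r R F. x \<in> frontier D \<Longrightarrow> 0 < r \<Longrightarrow> r < R \<Longrightarrow> finite F \<Longrightarrow>
        ball_cover (frontier D) x R r F \<Longrightarrow> C * (R / r) powr l \<le> real (card F)"
    using lower_assouad_dim_cover[OF dim] by auto
  \<comment> \<open>The part of \<open>M b\<^sup>n\<^sup>+\<^sup>s / m\<close> that does not depend on \<open>R\<close>.\<close>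
  define Q where "Q = 6 powr n * 2 powr n / (C * 2 powr (n + s) * \<kappa> powr n * \<kappa> powr n)"
  have Q: "Q > 0"
    using l \<kappa>01 by (simp add: Q_def)
  obtain R where R: "R > 1" "R powr (n - s - l) \<le> \<eta> / Q"
    using exists_powr_le[of "n - s - l" "\<eta> / Q"] l Q \<open>\<eta> > 0\<close> by auto
  define a where "a = \<kappa> / (2 * R)"
  define m where "m = C * R powr l * (\<omega> * a powr n)"
  define M where "M = \<omega> * (6 * R / \<kappa>) powr n"
  have m: "m > 0"
    using \<omega> \<kappa>01 R l by (simp add: m_def a_def)
  have "M * (1 / (2 * R)) powr (n + s) = m * (Q * R powr (n - s - l))"
    using \<kappa>01 R \<omega> l unfolding M_def m_def Q_def a_def
    by (simp add: powr_mult powr_divide powr_add powr_diff)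
  also have "\<dots> \<le> m * \<eta>"
    using R(2) Q m by (intro mult_left_mono) (auto simp: field_simps)
  finally have small: "M * (1 / (2 * R)) powr (n + s) \<le> \<eta> * m"
    by (simp add: mult.commute)
  let ?G = "pairing_region 3 a (1 / (2 * R)) D"
  have "?G \<in> sets (borel \<Otimes>\<^sub>M borel)"
    using D(1) by (intro sets_pairing_region) auto
  note [measurable] = this
  have meas: "{y. (x, y) \<in> ?G} \<in> sets borel" for x
    by measurable
  have "boundary_pairing 3 a (1 / (2 * R)) m M D"
    unfolding boundary_pairing_def d_def[symmetric, THEN fun_cong] n_def[symmetric]
  proof (intro conjI ballI)
    show "0 < 1 / (2 * R)" "0 < m" "0 \<le> M"
      using R m \<omega> by (auto simp: M_def)
  next
    fix x assume x: "x \<in> D"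
    have dx: "d x > 0" by (rule d[OF x])
    obtain z0 where z0: "z0 \<in> frontier D" "d x = dist x z0"
      using infdist_attains_inf[OF frontier_closed D(2)] unfolding d_def by metis
    define \<rho> where "\<rho> = d x / (2 * R)"
    have \<rho>: "\<rho> > 0" "2 * \<rho> < d x" "d x / (2 * \<rho>) = R"
      using dx R by (auto simp: \<rho>_def field_simps)
    obtain F where F: "finite F" "F \<subseteq> frontier D \<inter> ball z0 (d x)"
        "pairwise (\<lambda>x y. 2 * \<rho> \<le> dist x y) F"
        "frontier D \<inter> ball z0 (d x) \<subseteq> (\<Union>z\<in>F. ball z (2 * \<rho>))"
      using exists_maximal_separated_subset[of "frontier D \<inter> ball z0 (d x)" "2 * \<rho>"] \<rho>(1)
      by (auto simp: bounded_Int)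
    have card: "C * R powr l \<le> real (card F)"
      using cover[OF z0(1) _ \<rho>(2) F(1)] \<rho>(1,3) F(2,4) unfolding ball_cover_def by simp
    have "\<exists>w. ball w (\<kappa> * \<rho>) \<subseteq> D \<inter> ball z \<rho> \<and> (\<forall>y\<in>ball w (\<kappa> * \<rho>). \<kappa> * \<rho> \<le> d y)" if "z \<in> F" for z
    proof -
      have "z \<in> closure D"
        using that F(2) by (auto simp: frontier_def)
      then show ?thesis
        unfolding d_def by (rule corkscrewD[OF \<kappa> _ \<rho>(1)])
    qed
    then obtain w where w: "\<And>z. z \<in> F \<Longrightarrow> ball (w z) (\<kappa> * \<rho>) \<subseteq> D \<inter> ball z \<rho>"
        "\<And>z y. z \<in> F \<Longrightarrow> y \<in> ball (w z) (\<kappa> * \<rho>) \<Longrightarrow> \<kappa> * \<rho> \<le> d y"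
      by metis
    have disj: "disjoint_family_on (\<lambda>z. ball (w z) (\<kappa> * \<rho>)) F"
      unfolding disjoint_family_on_def
    proof (intro ballI impI)
      fix z z' assume z: "z \<in> F" "z' \<in> F" "z \<noteq> z'"
      then have "2 * \<rho> \<le> dist z z'"
        using F(3) by (auto simp: pairwise_def)
      then have "ball z \<rho> \<inter> ball z' \<rho> = {}"
        by (intro disjoint_ballI) simp
      then show "ball (w z) (\<kappa> * \<rho>) \<inter> ball (w z') (\<kappa> * \<rho>) = {}"
        using w(1)[OF z(1)] w(1)[OF z(2)] by blast
    qed
    have sub: "(\<Union>z\<in>F. ball (w z) (\<kappa> * \<rho>)) \<subseteq> {y. (x, y) \<in> ?G}"
    proof
      fix y assume "y \<in> (\<Union>z\<in>F. ball (w z) (\<kappa> * \<rho>))"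
      then obtain z where z: "z \<in> F" "y \<in> ball (w z) (\<kappa> * \<rho>)"
        by blast
      then have y: "y \<in> D" "dist z y < \<rho>" "\<kappa> * \<rho> \<le> d y"
        using w[OF z(1)] by auto
      have zz: "z \<in> frontier D" "dist z0 z < d x"
        using F(2) z(1) by auto
      have "d y \<le> dist y z"
        unfolding d_def by (rule infdist_le[OF zz(1)])
      then have "d y \<le> \<rho>"
        using y(2) by (simp add: dist_commute)
      moreover have "dist x y < 3 * d x"
        using dist_triangle[of x y z0] dist_triangle[of z0 y z] zz z0(2) y(2) \<rho> by linarith
      moreover have "a * d x = \<kappa> * \<rho>" "1 / (2 * R) * d x = \<rho>"
        by (auto simp: a_def \<rho>_def)
      ultimately show "y \<in> {y. (x, y) \<in> ?G}"
        using x y unfolding pairing_region_def d_def[symmetric, THEN fun_cong] by simp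
    qed
    have "ennreal (m * d x powr n) = ennreal (C * R powr l * (\<omega> * (\<kappa> * \<rho>) powr n))"
      using dx R \<kappa>01 by (simp add: m_def a_def \<rho>_def powr_mult powr_divide mult_ac)
    also have "\<dots> \<le> ennreal (real (card F) * (\<omega> * (\<kappa> * \<rho>) powr n))"
      using card \<omega> by (intro ennreal_leI mult_right_mono) auto
    also have "\<dots> = (\<Sum>z\<in>F. emeasure lborel (ball (w z) (\<kappa> * \<rho>)))"
      using \<rho>(1) \<omega> \<kappa>01 by (simp add: emeasure_ball_powr \<omega>_def n_def ennreal_mult' ennreal_of_nat_eq_real_of_nat)
    also have "\<dots> = emeasure lborel (\<Union>z\<in>F. ball (w z) (\<kappa> * \<rho>))"
      using disj F(1) by (intro sum_emeasure) auto
    also have "\<dots> \<le> emeasure lborel {y. (x, y) \<in> ?G}"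
      using sub meas by (intro emeasure_mono) auto
    finally show "ennreal (m * d x powr n) \<le> emeasure lborel {y. (x, y) \<in> ?G}" .
  next
    fix y assume y: "y \<in> D"
    have dy: "d y > 0" by (rule d[OF y])
    have "{x. (x, y) \<in> ?G} \<subseteq> ball y (6 * R / \<kappa> * d y)"
    proof
      fix x assume "x \<in> {x. (x, y) \<in> ?G}"
      then have "dist x y < 3 * d x" "a * d x \<le> d y"
        by (auto simp: pairing_region_def d_def)
      moreover from this(2) have "3 * d x \<le> 6 * R / \<kappa> * d y"
        using R \<kappa>01 by (simp add: a_def field_simps)
      ultimately show "x \<in> ball y (6 * R / \<kappa> * d y)"
        by (simp add: dist_commute)
    qed
    then have "emeasure lborel {x. (x, y) \<in> ?G} \<le> emeasure lborel (ball y (6 * R / \<kappa> * d y))"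
      by (intro emeasure_mono) auto
    also have "\<dots> = ennreal (M * d y powr n)"
    proof -
      have "(6 * R / \<kappa> * d y) powr n = (6 * R / \<kappa>) powr n * d y powr n"
        by (rule powr_mult)
      moreover have "0 < 6 * R / \<kappa> * d y"
        using dy R \<kappa>01 by simp
      ultimately show ?thesis
        by (simp only: emeasure_ball_powr M_def \<omega>_def n_def mult.assoc)
    qed
    finally show "emeasure lborel {x. (x, y) \<in> ?G} \<le> ennreal (M * d y powr n)" .
  qed simp
  with small show ?thesis by blast
qed

section \<open>Interpolation between the two endpoints\<close>

text \<open>The support is compact in \<open>D\<close>, so the weight is continuous on it. This finiteness is what permits
  absorption in the Hardy inequality and division in the Sobolev inequality.\<close>

lemma C0_weighted_integral_finite:
  fixes D :: "'a::euclidean_space set"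
  assumes D: "open D" "frontier D \<noteq> {}" and u: "u \<in> C0 D" and "\<alpha> > 0"
  shows "(\<integral>\<^sup>+x\<in>D. ennreal (\<bar>u x\<bar> powr \<alpha> / infdist x (frontier D) powr \<beta>) \<partial>lborel) < \<infinity>"
proof -
  define K where "K = closure {x \<in> D. u x \<noteq> 0}"
  have K: "compact K" "K \<subseteq> D" "continuous_on K u"
    using u by (auto simp: C0_def K_def intro: continuous_on_subset)
  have d: "infdist x (frontier D) > 0" if "x \<in> K" for x
    using infdist_frontier_pos[OF D] K(2) that by blast
  have "continuous_on K (\<lambda>x. \<bar>u x\<bar> powr \<alpha> / infdist x (frontier D) powr \<beta>)"
    using K(3) d \<open>\<alpha> > 0\<close>
    by (intro continuous_on_divide continuous_on_powr' continuous_on_rabs continuous_intros)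
       (auto dest!: d simp: less_le)
  then have "bounded ((\<lambda>x. \<bar>u x\<bar> powr \<alpha> / infdist x (frontier D) powr \<beta>) ` K)"
    using K(1) by (intro compact_imp_bounded compact_continuous_image)
  then obtain B where B: "\<And>x. x \<in> K \<Longrightarrow> \<bar>u x\<bar> powr \<alpha> / infdist x (frontier D) powr \<beta> \<le> B"
    unfolding bounded_iff by (auto simp: abs_le_iff)
  have "(\<integral>\<^sup>+x\<in>D. ennreal (\<bar>u x\<bar> powr \<alpha> / infdist x (frontier D) powr \<beta>) \<partial>lborel)
     \<le> (\<integral>\<^sup>+x. ennreal B * indicator K x \<partial>lborel)"
  proof (intro nn_integral_mono)
    fix x
    show "ennreal (\<bar>u x\<bar> powr \<alpha> / infdist x (frontier D) powr \<beta>) * indicator D x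
        \<le> ennreal B * indicator K x"
    proof (cases "x \<in> K")
      case True
      then show ?thesis
        using B[OF True] by (auto split: split_indicator intro: ennreal_leI)
    next
      case False
      have "{x \<in> D. u x \<noteq> 0} \<subseteq> K"
        unfolding K_def by (rule closure_subset)
      then have "u x = 0" if "x \<in> D"
        using False that by auto
      then show ?thesis
        by (simp split: split_indicator)
    qed
  qed
  also have "\<dots> = ennreal B * emeasure lborel K"
    using K(1) by (simp add: nn_integral_cmult_indicator borel_compact)
  also have "\<dots> < \<infinity>"
    using emeasure_compact_finite[OF K(1)] by (simp add: ennreal_mult_less_top)
  finally show ?thesis .
qed

text \<open>A weighted geometric mean of two nonnegative numbers is at most their maximum, hence at most their
  sum. Normalising by \<open>H\<close> and \<open>T\<close> before estimating replaces Hoelder's inequality after integration.\<close>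

lemma weight_interpolation:
  fixes t d H T :: real
  assumes "t \<ge> 0" "d > 0" "H > 0" "T > 0" "\<alpha> \<ge> 0" "\<beta> \<ge> 0" "\<alpha> + \<beta> = 1"
  shows "t powr (\<alpha> * p + \<beta> * P) / d powr (\<alpha> * s)
    \<le> H powr \<alpha> * T powr \<beta> * (t powr p / d powr s / H + t powr P / T)"
proof (cases "t = 0")
  case False
  define X where "X = t powr p / d powr s / H"
  define Y where "Y = t powr P / T"
  have XY: "X > 0" "Y > 0"
    using False assms by (auto simp: X_def Y_def)
  have "t powr (\<alpha> * p + \<beta> * P) / d powr (\<alpha> * s) = H powr \<alpha> * T powr \<beta> * (X powr \<alpha> * Y powr \<beta>)"
    using assms by (simp add: X_def Y_def powr_divide powr_mult powr_powr powr_add mult_ac)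
  also have "X powr \<alpha> * Y powr \<beta> \<le> max X Y powr \<alpha> * max X Y powr \<beta>"
    using XY assms by (intro mult_mono powr_mono2) auto
  also have "\<dots> = max X Y"
    using XY assms by (simp add: powr_add[symmetric])
  also have "\<dots> \<le> X + Y"
    using XY by auto
  finally show ?thesis
    by (simp add: X_def Y_def mult_left_mono)
qed simp

text \<open>Take \<open>H = S\<close> and \<open>T = S\<^sup>P\<^sup>/\<^sup>p\<close> as normalising constants. If \<open>S = 0\<close>, these are not allowed, but then the
  Sobolev inequality forces \<open>u\<close> to vanish almost everywhere in \<open>D\<close>.\<close>

lemma hardy_sobolev_interpolation:
  fixes u :: "'a::euclidean_space \<Rightarrow> real" and d :: "'a \<Rightarrow> real" and D :: "'a set"
  assumes [measurable]: "D \<in> sets borel" "u \<in> borel_measurable borel" "d \<in> borel_measurable borel"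
    and d: "\<And>x. x \<in> D \<Longrightarrow> d x > 0"
    and ab: "\<alpha> \<ge> 0" "\<beta> \<ge> 0" "\<alpha> + \<beta> = 1" and "p > 0" "S \<ge> 0" "C1 \<ge> 0" "C2 \<ge> 0"
    and hardy: "(\<integral>\<^sup>+x\<in>D. ennreal (\<bar>u x\<bar> powr p / d x powr s) \<partial>lborel) \<le> ennreal (C1 * S)"
    and sobolev: "(\<integral>\<^sup>+x\<in>D. ennreal (\<bar>u x\<bar> powr P) \<partial>lborel) \<le> ennreal (C2 * S powr (P / p))"
  shows "(\<integral>\<^sup>+x\<in>D. ennreal (\<bar>u x\<bar> powr (\<alpha> * p + \<beta> * P) / d x powr (\<alpha> * s)) \<partial>lborel)
     \<le> ennreal ((C1 + C2) * S powr ((\<alpha> * p + \<beta> * P) / p))"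
proof (cases "S = 0")
  case True
  then have "(\<integral>\<^sup>+x\<in>D. ennreal (\<bar>u x\<bar> powr P) \<partial>lborel) = 0"
    using sobolev by simp
  then have "AE x in lborel. ennreal (\<bar>u x\<bar> powr P) * indicator D x = 0"
    by (subst (asm) nn_integral_0_iff_AE) auto
  then have "AE x in lborel.
      ennreal (\<bar>u x\<bar> powr (\<alpha> * p + \<beta> * P) / d x powr (\<alpha> * s)) * indicator D x = 0"
    by eventually_elim (auto split: split_indicator_asm)
  then have "(\<integral>\<^sup>+x\<in>D. ennreal (\<bar>u x\<bar> powr (\<alpha> * p + \<beta> * P) / d x powr (\<alpha> * s)) \<partial>lborel) = 0"
    by (subst nn_integral_0_iff_AE) auto
  then show ?thesis by simp
next
  case False
  then have S: "S > 0" using \<open>S \<ge> 0\<close> by simp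
  define T where "T = S powr (P / p)"
  define c where "c = S powr \<alpha> * T powr \<beta>"
  have T: "T > 0" using S by (simp add: T_def)
  have c: "c = S powr ((\<alpha> * p + \<beta> * P) / p)"
    using \<open>p > 0\<close> unfolding c_def T_def powr_powr powr_add[symmetric] by (simp add: add_divide_distrib mult.commute)
  have "(\<integral>\<^sup>+x\<in>D. ennreal (\<bar>u x\<bar> powr (\<alpha> * p + \<beta> * P) / d x powr (\<alpha> * s)) \<partial>lborel)
     \<le> (\<integral>\<^sup>+x. ennreal (c / S) * (ennreal (\<bar>u x\<bar> powr p / d x powr s) * indicator D x)
          + ennreal (c / T) * (ennreal (\<bar>u x\<bar> powr P) * indicator D x) \<partial>lborel)"
  proof (intro nn_integral_mono)
    fix x
    show "ennreal (\<bar>u x\<bar> powr (\<alpha> * p + \<beta> * P) / d x powr (\<alpha> * s)) * indicator D x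
      \<le> ennreal (c / S) * (ennreal (\<bar>u x\<bar> powr p / d x powr s) * indicator D x)
          + ennreal (c / T) * (ennreal (\<bar>u x\<bar> powr P) * indicator D x)"
    proof (cases "x \<in> D")
      case True
      have "\<bar>u x\<bar> powr (\<alpha> * p + \<beta> * P) / d x powr (\<alpha> * s)
          \<le> c / S * (\<bar>u x\<bar> powr p / d x powr s) + c / T * \<bar>u x\<bar> powr P"
        using weight_interpolation[OF _ d[OF True] S T ab, of "\<bar>u x\<bar>" p P s]
        by (simp add: c_def distrib_left mult.commute)
      then show ?thesis
        using True S T by (simp add: c_def ennreal_mult'[symmetric] ennreal_plus[symmetric] ennreal_leI
            del: ennreal_plus)
    qed simp
  qed
  also have "\<dots> = ennreal (c / S) * (\<integral>\<^sup>+x\<in>D. ennreal (\<bar>u x\<bar> powr p / d x powr s) \<partial>lborel)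
      + ennreal (c / T) * (\<integral>\<^sup>+x\<in>D. ennreal (\<bar>u x\<bar> powr P) \<partial>lborel)"
    by (simp add: nn_integral_add nn_integral_cmult)
  also have "\<dots> \<le> ennreal (c / S) * ennreal (C1 * S) + ennreal (c / T) * ennreal (C2 * T)"
    using hardy sobolev unfolding T_def[symmetric] by (intro add_mono mult_left_mono) auto
  also have "\<dots> = ennreal ((C1 + C2) * c)"
    using S T \<open>C1 \<ge> 0\<close> \<open>C2 \<ge> 0\<close>
    by (simp add: c_def ennreal_mult'[symmetric] ennreal_plus[symmetric] distrib_right mult.commute
        del: ennreal_plus)
  finally show ?thesis
    unfolding c .
qed

section \<open>The fractional Hardy inequality in unbounded John domains\<close>

theorem corollary6p3:
  fixes D :: "'a::euclidean_space set" and c \<delta> p q :: real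
  assumes "DIM('a) \<ge> 2"
    and "c \<ge> 1"
    and "john_domain c D"
    and "\<not> bounded D"
    and "D \<noteq> UNIV"
    and "0 < \<delta>" and "\<delta> < 1"
    and "1 \<le> p" and "1 \<le> q"
    and "p < real DIM('a) / \<delta>"
    and "0 \<le> 1 / p - 1 / q" and "1 / p - 1 / q \<le> \<delta> / real DIM('a)"
    and "upper_assouad_dim (frontier D) < ereal (real DIM('a) - \<delta> * p)
      \<or> (lower_assouad_dim (frontier D) > ereal (real DIM('a) - \<delta> * p)
          \<and> \<not> bounded (frontier D))"
  shows "fractional_hardy \<delta> q p D"
proof -
  define n where "n = real DIM('a)"
  define s where "s = \<delta> * p"
  define P where "P = n * p / (n - s)"
  define \<alpha> where "\<alpha> = (P - q) / (P - p)"
  define \<beta> where "\<beta> = (q - p) / (P - p)"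
  define d where "d = (\<lambda>x. infdist x (frontier D))"
  have n: "n > 0" by (simp add: n_def)
  have s: "0 < s" "s < n"
    using assms(6,8,10) by (auto simp: s_def n_def field_simps)
  have D: "open D" "frontier D \<noteq> {}"
    using assms(3,5) by (auto simp: john_domain_def domain_def frontier_eq_empty)
  have [measurable]: "D \<in> sets borel" "d \<in> borel_measurable borel"
    using D(1) by (auto simp: d_def)
  have d: "d x > 0" if "x \<in> D" for x
    using infdist_frontier_pos[OF D that] by (simp add: d_def)
  have \<kappa>: "corkscrew (1 / (8 * c)) D"
    using john_domain_corkscrew assms(2-4) by blast
  have Pp: "P - p = p * s / (n - s)"
    using s by (simp add: P_def field_simps)
  moreover have "p * s / (n - s) > 0"
    using s assms(8) by simp
  ultimately have pP: "p < P"
    by linarith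
  have "p \<le> q"
    using assms(8,9,11) by (intro inverse_le_imp_le[of q p]) (auto simp: inverse_eq_divide)
  have "1 / P = 1 / p - \<delta> / n"
    using s n assms(8) by (simp add: P_def s_def field_simps)
  then have "1 / P \<le> 1 / q"
    using assms(12) by (simp add: n_def)
  then have "q \<le> P"
    using pP assms(8,9) by (intro inverse_le_imp_le[of P q]) (auto simp: inverse_eq_divide)
  have ab: "\<alpha> \<ge> 0" "\<beta> \<ge> 0" "\<alpha> + \<beta> = 1"
    using pP \<open>p \<le> q\<close> \<open>q \<le> P\<close> by (auto simp: \<alpha>_def \<beta>_def add_divide_distrib[symmetric])
  have q: "\<alpha> * p + \<beta> * P = q"
  proof -
    have "\<alpha> * p + \<beta> * P = ((P - q) * p + (q - p) * P) / (P - p)"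
      by (simp add: \<alpha>_def \<beta>_def add_divide_distrib)
    also have "(P - q) * p + (q - p) * P = q * (P - p)"
      by (simp add: algebra_simps)
    finally show ?thesis
      using pP by simp
  qed
  \<comment> \<open>With these weights the power of the distance is exactly the one in the claim.\<close>
  have e: "\<alpha> * s = q * (\<delta> + n * (1 / q - 1 / p))"
  proof -
    have "A / (p * s / N) * s = A * N / p" if "N > 0" for A N
      using that s assms(8) by simp
    from this[of "n - s" "P - q"] have "\<alpha> * s = (P - q) * (n - s) / p"
      using s unfolding \<alpha>_def Pp by linarith
    also have "\<dots> = (n * p - q * (n - s)) / p"
      using s by (simp add: P_def left_diff_distrib)
    also have "\<dots> = q * (\<delta> + n * (1 / q - 1 / p))"
      using assms(8,9) by (simp add: s_def field_simps)
    finally show ?thesis .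
  qed
  define \<eta> :: real where "\<eta> = 1 / 2 powr (p + 1)"
  have \<eta>: "\<eta> > 0" by (simp add: \<eta>_def)
  have "\<exists>K a b m M. boundary_pairing K a b m M D \<and> M * b powr (n + s) \<le> \<eta> * m"
    using assms(13) thin_boundary_pairing[OF D \<kappa> _ \<eta>, of s] thick_boundary_pairing[OF D \<kappa> _ _ \<eta>, of s]
    unfolding n_def s_def by argo
  then obtain K a b m M where pairing: "boundary_pairing K a b m M D"
      and "M * b powr (n + s) \<le> \<eta> * m"
    by (elim exE conjE)
  then have small: "2 powr (p + 1) * (M * b powr (n + s)) \<le> m"
    by (simp add: \<eta>_def field_simps del: powr_add)
  have "K > 0 \<and> m > 0"
    using pairing unfolding boundary_pairing_def by (elim conjE) (intro conjI)
  then have Km: "K > 0" "m > 0" by simp_all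
  define C1 where "C1 = 2 powr (p + 1) * K powr (n + s) / m"
  define k where "k = unit_ball_vol n * (1 / (8 * c)) powr n"
  define C2 where "C2 = (2 powr P * (2 / k) powr (1 + s / n)) powr (P / p)"
  have k: "k > 0"
    using assms(2) by (simp add: k_def n_def)
  have C: "C1 > 0" "C2 > 0"
    using Km k by (auto simp: C1_def C2_def)
  show ?thesis
    unfolding fractional_hardy_def n_def[symmetric] e[symmetric] s_def[symmetric]
      d_def[symmetric, THEN fun_cong]
  proof (intro exI[of _ "C1 + C2"] conjI ballI)
    show "C1 + C2 > 0" using C by simp
    fix u assume u: "u \<in> C0 D"
    \<comment> \<open>Values of \<open>u\<close> outside \<open>D\<close> are arbitrary; extending by zero gives a Borel function.\<close>
    define v where "v x = indicator D x *\<^sub>R u x" for x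
    have v: "v x = u x" if "x \<in> D" for x
      using that by (simp add: v_def)
    have "continuous_on D u"
      using u unfolding C0_def by blast
    then have [measurable]: "v \<in> borel_measurable borel"
      unfolding v_def by (intro borel_measurable_continuous_on_indicator) measurable
    have uv: "(\<integral>\<^sup>+x\<in>D. f x (u x) \<partial>lborel) = (\<integral>\<^sup>+x\<in>D. f x (v x) \<partial>lborel)" for f :: "'a \<Rightarrow> real \<Rightarrow> ennreal"
      by (intro nn_integral_cong) (simp add: v split: split_indicator)
    have gag: "(\<integral>\<^sup>+x\<in>D. (\<integral>\<^sup>+y\<in>D. ennreal (\<bar>u x - u y\<bar> powr p / norm (x - y) powr (n + s)) \<partial>lborel) \<partial>lborel)
        = gagliardo s p D v"
      unfolding gagliardo_def n_def
      by (intro nn_integral_cong) (auto simp: v split: split_indicator intro!: nn_integral_cong)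
    have fin: "(\<integral>\<^sup>+x\<in>D. ennreal (\<bar>v x\<bar> powr p / d x powr s) \<partial>lborel) < \<infinity>"
      using C0_weighted_integral_finite[OF D u, of p s] assms(8)
      unfolding uv[of "\<lambda>x t. ennreal (\<bar>t\<bar> powr p / d x powr s)", symmetric] by (simp add: d_def)
    have "(\<integral>\<^sup>+x\<in>D. ennreal (\<bar>v x\<bar> powr P) \<partial>lborel) = (\<integral>\<^sup>+x\<in>D. ennreal (\<bar>u x\<bar> powr P / d x powr 0) \<partial>lborel)"
      by (intro nn_integral_cong) (auto simp: v split: split_indicator dest: d)
    then have finP: "(\<integral>\<^sup>+x\<in>D. ennreal (\<bar>v x\<bar> powr P) \<partial>lborel) < \<infinity>"
      using C0_weighted_integral_finite[OF D u, of P 0] pP assms(8) by (simp add: d_def)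
    show "(\<integral>\<^sup>+x\<in>D. ennreal (\<bar>u x\<bar> powr q / d x powr (\<alpha> * s)) \<partial>lborel)
      \<le> ennreal (C1 + C2) * ennreal_powr
        (\<integral>\<^sup>+x\<in>D. (\<integral>\<^sup>+y\<in>D. ennreal (\<bar>u x - u y\<bar> powr p / norm (x - y) powr (n + s)) \<partial>lborel) \<partial>lborel) (q / p)"
      unfolding gag uv[of "\<lambda>x t. ennreal (\<bar>t\<bar> powr q / d x powr (\<alpha> * s))"]
    proof (cases "gagliardo s p D v")
      case top
      have "ennreal_powr (gagliardo s p D v) (q / p) = top"
        unfolding top ennreal_powr_def infinity_ennreal_def by (rule if_P) (rule refl)
      moreover have "ennreal (C1 + C2) * top = top"
        using C by (subst ennreal_mult_top) (simp add: ennreal_eq_0_iff)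
      ultimately show "(\<integral>\<^sup>+x\<in>D. ennreal (\<bar>v x\<bar> powr q / d x powr (\<alpha> * s)) \<partial>lborel)
        \<le> ennreal (C1 + C2) * ennreal_powr (gagliardo s p D v) (q / p)"
        by (simp only: top_greatest)
    next
      case (real S)
      have "(\<integral>\<^sup>+x\<in>D. ennreal (\<bar>v x\<bar> powr p / d x powr s) \<partial>lborel)
          \<le> ennreal C1 * gagliardo s p D v"
        using fin small unfolding d_def C1_def n_def
        by (intro hardy_inequality_of_boundary_pairing[OF D _ assms(8) s(1) pairing]) simp_all
      also have "\<dots> = ennreal (C1 * S)"
        using real C by (simp add: ennreal_mult)
      finally have hardy: "(\<integral>\<^sup>+x\<in>D. ennreal (\<bar>v x\<bar> powr p / d x powr s) \<partial>lborel) \<le> ennreal (C1 * S)" .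
      have "p > 0" using assms(8) by simp
      have density: "ennreal (k * r powr real DIM('a)) \<le> emeasure lborel (D \<inter> ball x r)"
        if "x \<in> D" "r > 0" for x r
        using corkscrew_measure_density[OF \<kappa> that] by (simp add: k_def n_def)
      have "(\<integral>\<^sup>+x\<in>D. ennreal (\<bar>v x\<bar> powr P) \<partial>lborel) \<le>
          ennreal ((2 powr P * (2 / k) powr (1 + s / n) * S) powr (P / p))"
        unfolding n_def
        by (rule sobolev_inequality[OF _ _ k s(1) s(2)[unfolded n_def] \<open>p > 0\<close> P_def[unfolded n_def]
              density finP real(2,1)]) measurable
      also have "(2 powr P * (2 / k) powr (1 + s / n) * S) powr (P / p) = C2 * S powr (P / p)"
        unfolding C2_def by (rule powr_mult)
      finally have sobolev: "(\<integral>\<^sup>+x\<in>D. ennreal (\<bar>v x\<bar> powr P) \<partial>lborel) \<le> ennreal (C2 * S powr (P / p))" .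
      have "(\<integral>\<^sup>+x\<in>D. ennreal (\<bar>v x\<bar> powr (\<alpha> * p + \<beta> * P) / d x powr (\<alpha> * s)) \<partial>lborel)
        \<le> ennreal ((C1 + C2) * S powr ((\<alpha> * p + \<beta> * P) / p))"
        by (rule hardy_sobolev_interpolation[OF _ _ _ d ab \<open>p > 0\<close> real(1)
              less_imp_le[OF C(1)] less_imp_le[OF C(2)] hardy sobolev]) measurable
      also have "\<dots> = ennreal (C1 + C2) * ennreal_powr (gagliardo s p D v) (q / p)"
        using C real(1) unfolding q real(2) by (simp add: ennreal_powr_def ennreal_mult')
      finally show "(\<integral>\<^sup>+x\<in>D. ennreal (\<bar>v x\<bar> powr q / d x powr (\<alpha> * s)) \<partial>lborel)
        \<le> ennreal (C1 + C2) * ennreal_powr (gagliardo s p D v) (q / p)"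
        unfolding q .
    qed
  qed
qed

end
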